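(* For each $k$ let $X_1,\dots,X_k$ be independent with $X_i\sim\mathrm{Binomial}(n_i,\pi)$, where $\pi=\pi^{(k)}\in(0,1)$ is common to all $i$ (the null hypothesis $H_0$), $n_i=n_i^{(k)}\ge4$, and $\pi\le\delta$ for some constant $\delta<1$ not depending on $k$. Let $\theta=\pi(1-\pi)$ and $N=\sum_{i=1}^kn_i$. Suppose that, as $k\to\infty$, $$\frac{\theta^3\sum_{i=1}^k\frac1{n_i}+\theta\sum_{i=1}^k\frac1{n_i^3}}{\left(k\theta^2+\frac{\theta}{N^2}\sum_{i=1}^k\frac1{n_i}\right)^2}\to0\qquad\text{and}\qquad\frac{\sum_{i=1}^k\frac1{n_i}}{k\theta^3}\to0 .$$ Then, as $k\to\infty$, $T_{new1}=\dfrac{T}{\sqrt{\hat{\mathcal V}_1}}\to N(0,1)$ in distribution and $T_{new2}=\dfrac{T}{\sqrt{\hat{\mathcal V}_{1*}}}\to N(0,1)$ in distribution, where $T$, $\hat{\mathcal V}_1$, $\hat{\mathcal V}_{1*}$ are defined in the context.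
   Context: Triangular array setting: $n_i,\pi$ may vary with $k$; the superscript is suppressed. $\hat\pi_i=X_i/n_i$ and $\hat{\bar\pi}=\hat\pi=\frac1N\sum_{i=1}^kn_i\hat\pi_i$. Put $d_i=\frac{n_i}{n_i-1}\left(1-\frac{n_i}N\right)$ and $$T=\sum_{i=1}^kn_i(\hat\pi_i-\hat{\bar\pi})^2-\sum_{i=1}^kd_i\hat\pi_i(1-\hat\pi_i).$$ Let $$\mathcal A_{1i}=2-\frac6{n_i}-\frac{d_i^2}{n_i}+\frac{8d_i^2}{n_i^2}-\frac{6d_i^2}{n_i^3}+12d_i\frac{n_i-1}{n_i^2},\qquad \mathcal A_{2i}=\frac{n_i}{N^2},$$ $$a_{1i}=\mathcal A_{2i},\quad a_{2i}=\mathcal A_{1i}-\mathcal A_{2i},\quad a_{3i}=-2\mathcal A_{1i},\quad a_{4i}=\mathcal A_{1i}.$$ For $l=1,2,3,4$ let $$\hat\eta_{li}=\frac{n_i^l}{\prod_{j=0}^{l-1}(n_i-j)}\prod_{j=0}^{l-1}\left(\hat\pi_i-\frac j{n_i}\right),\qquad \hat\eta_l=\frac{N^l}{\prod_{j=0}^{l-1}(N-j)}\prod_{j=0}^{l-1}\left(\hat\pi-\frac jN\right),$$ and $$\hat{\mathcal V}_1=\sum_{i=1}^k\sum_{l=1}^4a_{li}\hat\eta_{li},\qquad\hat{\mathcal V}_{1*}=\sum_{i=1}^k\sum_{l=1}^4a_{li}\hat\eta_l .$$ $T_{new1}$ and $T_{new2}$ are given an arbitrary value where the variance estimator is not positive.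 *)

theory Defs
  imports "HOL-Probability.Probability"
begin

text \<open>
  All quantities refer to a single row of the triangular array: \<open>k\<close> is the number of groups, which
  are indexed by \<open>{1..k}\<close>, \<open>n i\<close> is the size of group \<open>i\<close>, and \<open>x i\<close> is its observed number of
  successes.
\<close>

definition total_size :: "nat \<Rightarrow> (nat \<Rightarrow> nat) \<Rightarrow> nat" where
  "total_size k n = (\<Sum>i=1..k. n i)"

definition pi_hat :: "(nat \<Rightarrow> nat) \<Rightarrow> (nat \<Rightarrow> nat) \<Rightarrow> nat \<Rightarrow> real" where
  "pi_hat n x i = real (x i) / real (n i)"

definition pi_hat_pooled :: "nat \<Rightarrow> (nat \<Rightarrow> nat) \<Rightarrow> (nat \<Rightarrow> nat) \<Rightarrow> real" where
  "pi_hat_pooled k n x = 1 / real (total_size k n) * (\<Sum>i=1..k. real (n i) * pi_hat n x i)"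

definition d_coeff :: "nat \<Rightarrow> (nat \<Rightarrow> nat) \<Rightarrow> nat \<Rightarrow> real" where
  "d_coeff k n i =
     real (n i) / (real (n i) - 1) * (1 - real (n i) / real (total_size k n))"

definition T_stat :: "nat \<Rightarrow> (nat \<Rightarrow> nat) \<Rightarrow> (nat \<Rightarrow> nat) \<Rightarrow> real" where
  "T_stat k n x =
     (\<Sum>i=1..k. real (n i) * (pi_hat n x i - pi_hat_pooled k n x)^2)
     - (\<Sum>i=1..k. d_coeff k n i * pi_hat n x i * (1 - pi_hat n x i))"

definition A1_coeff :: "nat \<Rightarrow> (nat \<Rightarrow> nat) \<Rightarrow> nat \<Rightarrow> real" where
  "A1_coeff k n i =
     (let m = real (n i); d = d_coeff k n i in
        2 - 6 / m - d^2 / m + 8 * d^2 / m^2 - 6 * d^2 / m^3 + 12 * d * ((m - 1) / m^2))"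

definition A2_coeff :: "nat \<Rightarrow> (nat \<Rightarrow> nat) \<Rightarrow> nat \<Rightarrow> real" where
  "A2_coeff k n i = real (n i) / (real (total_size k n))^2"

definition a_coeff :: "nat \<Rightarrow> (nat \<Rightarrow> nat) \<Rightarrow> nat \<Rightarrow> nat \<Rightarrow> real" where
  "a_coeff k n l i =
     (if l = 1 then A2_coeff k n i
      else if l = 2 then A1_coeff k n i - A2_coeff k n i
      else if l = 3 then - 2 * A1_coeff k n i
      else if l = 4 then A1_coeff k n i
      else 0)"

text \<open>
  For \<open>Y\<close> binomial with parameters \<open>m \<ge> l\<close> and \<open>p\<close>, \<open>eta_hat m (Y / m) l\<close> is the unbiased
  estimator of \<open>p ^ l\<close>. It is used both for a single group and for the pooled sample.
\<close>

definition eta_hat :: "nat \<Rightarrow> real \<Rightarrow> nat \<Rightarrow> real" where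
  "eta_hat m q l =
     real m ^ l / (\<Prod>j<l. real m - real j) * (\<Prod>j<l. q - real j / real m)"

definition V1_hat :: "nat \<Rightarrow> (nat \<Rightarrow> nat) \<Rightarrow> (nat \<Rightarrow> nat) \<Rightarrow> real" where
  "V1_hat k n x =
     (\<Sum>i=1..k. \<Sum>l=1..4. a_coeff k n l i * eta_hat (n i) (pi_hat n x i) l)"

definition V1_star_hat :: "nat \<Rightarrow> (nat \<Rightarrow> nat) \<Rightarrow> (nat \<Rightarrow> nat) \<Rightarrow> real" where
  "V1_star_hat k n x =
     (\<Sum>i=1..k. \<Sum>l=1..4. a_coeff k n l i * eta_hat (total_size k n) (pi_hat_pooled k n x) l)"

text \<open>
  The first argument \<open>r\<close> is the arbitrary value taken when the variance estimator is not positive.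
\<close>

definition T_new1 :: "real \<Rightarrow> nat \<Rightarrow> (nat \<Rightarrow> nat) \<Rightarrow> (nat \<Rightarrow> nat) \<Rightarrow> real" where
  "T_new1 r k n x = (if V1_hat k n x > 0 then T_stat k n x / sqrt (V1_hat k n x) else r)"

definition T_new2 :: "real \<Rightarrow> nat \<Rightarrow> (nat \<Rightarrow> nat) \<Rightarrow> (nat \<Rightarrow> nat) \<Rightarrow> real" where
  "T_new2 r k n x =
     (if V1_star_hat k n x > 0 then T_stat k n x / sqrt (V1_star_hat k n x) else r)"

end

theory Submission
  imports Defs
begin

text \<open>
  Write \<open>Y\<^sub>i = X\<^sub>i - n\<^sub>i \<pi>\<close>, \<open>s = \<theta> \<surd>(2k)\<close> and \<open>c = (\<Sum> 1 / n\<^sub>i) / (k \<theta>\<^sup>3)\<close>. The second condition says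
  \<open>c \<rightarrow> 0\<close>, and all errors are controlled by \<open>c\<close>, \<open>\<surd>c\<close> and \<open>1 / \<surd>k\<close>.
  Algebraically \<open>T = \<Sum> (Y\<^sub>i\<^sup>2 / n\<^sub>i - \<theta>) + R\<close>, where \<open>R\<close> collects \<open>(\<Sum> Y\<^sub>i)\<^sup>2 / N - \<theta>\<close>, of mean absolute value
  at most \<open>2\<theta>\<close>, and a sum of independent centred terms whose variance is \<open>O(\<theta> \<Sum> 1 / n\<^sub>i)\<close>; so \<open>R / s\<close>
  vanishes in mean. The main sum, divided by \<open>s\<close>, obeys Lyapunov's theorem with third absolute moments,
  which the sixth central moment of the binomial distribution controls. Both variance estimators
  differ from \<open>2 \<Sum> (q\<^sub>i (1 - q\<^sub>i))\<^sup>2\<close>, with \<open>q\<^sub>i\<close> the group proportion or the pooled one, by \<open>O(\<Sum> 1 / n\<^sub>i)\<close>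
  deterministically, and \<open>E \<bar>q\<^sub>i - \<pi>\<bar> \<le> \<surd>(\<theta> / n\<^sub>i)\<close> then gives \<open>V / s\<^sup>2 \<rightarrow> 1\<close> in mean.
\<close>

section \<open>Central moments of the binomial distribution\<close>

lemma mult_one_minus_le_quarter: "x * (1 - x) \<le> 1 / 4" for x :: real
  using zero_le_power2[of "1 - 2 * x"] by (simp add: power2_eq_square algebra_simps)

text \<open>Conditioning on a single trial, which succeeds with probability \<open>p\<close>
  independently of the other \<open>n\<close>, gives the recursion behind all the central moments
  below.\<close>

lemma expectation_binomial_pmf_Suc:
  fixes f :: "nat \<Rightarrow> real"
  assumes p: "p \<in> {0..1}"
  shows "measure_pmf.expectation (binomial_pmf (Suc n) p) f =
    p * measure_pmf.expectation (binomial_pmf n p) (\<lambda>x. f (Suc x))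
    + (1 - p) * measure_pmf.expectation (binomial_pmf n p) f"
proof -
  have fin: "finite (set_pmf (binomial_pmf n p))" using p by auto
  have "binomial_pmf (Suc n) p = bernoulli_pmf p \<bind> (\<lambda>b. map_pmf (\<lambda>x. (if b then 1 else 0) + x) (binomial_pmf n p))"
    using p by (simp add: binomial_pmf_Suc map_pmf_def)
  also have "measure_pmf.expectation \<dots> f =
     measure_pmf.expectation (bernoulli_pmf p) (\<lambda>b. measure_pmf.expectation (map_pmf (\<lambda>x. (if b then 1 else 0) + x) (binomial_pmf n p)) f)"
    by (subst pmf_expectation_bind[where A=UNIV]) (use fin in \<open>auto simp: integral_measure_pmf[of UNIV]\<close>)
  finally show ?thesis using p by simp
qed

definition binomial_cmoment :: "nat \<Rightarrow> nat \<Rightarrow> real \<Rightarrow> real" where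
  "binomial_cmoment j n p = measure_pmf.expectation (binomial_pmf n p) (\<lambda>x. (real x - real n * p) ^ j)"

text \<open>One more trial adds to the centred count an independent centred step, equal to
  \<open>1 - p\<close> or \<open>- p\<close>; the binomial theorem expands the \<open>j\<close>-th
  power of the sum.\<close>

lemma binomial_cmoment_Suc:
  assumes p: "p \<in> {0..1}"
  shows "binomial_cmoment j (Suc n) p =
    (\<Sum>i\<le>j. real (j choose i) * binomial_cmoment i n p * (p * (1 - p) ^ (j - i) + (1 - p) * (- p) ^ (j - i)))"
proof -
  let ?E = "measure_pmf.expectation (binomial_pmf n p)"
  have 1: "?E (\<lambda>x. (real x - real n * p + c) ^ j) = (\<Sum>i\<le>j. real (j choose i) * binomial_cmoment i n p * c ^ (j - i))" for c
    using p by (simp add: binomial_ring Bochner_Integration.integral_sum binomial_cmoment_def)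
  have "binomial_cmoment j (Suc n) p = p * ?E (\<lambda>x. (real x - real n * p + (1 - p)) ^ j)
     + (1 - p) * ?E (\<lambda>x. (real x - real n * p + (- p)) ^ j)"
    unfolding binomial_cmoment_def expectation_binomial_pmf_Suc[OF p] by (simp add: algebra_simps)
  also have "\<dots> = (\<Sum>i\<le>j. real (j choose i) * binomial_cmoment i n p * (p * (1 - p) ^ (j - i) + (1 - p) * (- p) ^ (j - i)))"
    unfolding 1 sum_distrib_left sum.distrib[symmetric] by (intro sum.cong) (auto simp: algebra_simps)
  finally show ?thesis .
qed

lemma binomial_cmoment_0n: "p \<in> {0..1} \<Longrightarrow> binomial_cmoment j 0 p = 0 ^ j"
  by (simp add: binomial_cmoment_def binomial_pmf_0)

lemma binomial_cmoment_0 [simp]: "binomial_cmoment 0 n p = 1"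
  by (simp add: binomial_cmoment_def)

context
  fixes p \<theta> :: real
  assumes p: "p \<in> {0..1}" and \<theta>: "\<theta> = p * (1 - p)"
begin

text \<open>The \<open>j\<close>-th central moment of a single Bernoulli trial.\<close>

private definition step_moment :: "nat \<Rightarrow> real" where
  "step_moment j = p * (1 - p) ^ j + (1 - p) * (- p) ^ j"

private lemma step_moment_values:
  "step_moment 0 = 1" "step_moment (Suc 0) = 0" "step_moment 2 = \<theta>"
  "step_moment 3 = \<theta> * (1 - 2 * p)" "step_moment 4 = \<theta> * (1 - 3 * \<theta>)"
  "step_moment 6 = \<theta> * (1 - 5 * \<theta> + 5 * \<theta> ^ 2)"
  unfolding step_moment_def \<theta> by (simp_all add: eval_nat_numeral algebra_simps)

private lemma cmoment_rec:
  "binomial_cmoment j (Suc n) p = (\<Sum>i\<le>j. real (j choose i) * binomial_cmoment i n p * step_moment (j - i))"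
  unfolding step_moment_def by (rule binomial_cmoment_Suc[OF p])

lemma binomial_cmoment_1: "binomial_cmoment (Suc 0) n p = 0"
proof (induction n)
  case (Suc n)
  then show ?case by (simp add: cmoment_rec step_moment_values)
qed (simp add: binomial_cmoment_0n[OF p])

lemma binomial_cmoment_2: "binomial_cmoment 2 n p = n * \<theta>"
proof (induction n)
  case (Suc n)
  have "binomial_cmoment 2 (Suc n) p = binomial_cmoment 2 n p + \<theta>"
    unfolding cmoment_rec
    by (simp add: atMost_nat_numeral binomial_cmoment_1 step_moment_values atMost_Suc)
  with Suc show ?case by (simp add: algebra_simps)
qed (simp add: binomial_cmoment_0n[OF p])

lemma binomial_cmoment_3: "binomial_cmoment 3 n p = n * \<theta> * (1 - 2 * p)"
proof (induction n)
  case (Suc n)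
  have "binomial_cmoment 3 (Suc n) p = binomial_cmoment 3 n p + \<theta> * (1 - 2 * p)"
    unfolding cmoment_rec
    by (simp add: atMost_nat_numeral binomial_cmoment_1 step_moment_values atMost_Suc)
  with Suc show ?case by (simp add: algebra_simps)
qed (simp add: binomial_cmoment_0n[OF p])

lemma binomial_cmoment_4: "binomial_cmoment 4 n p = 3 * (n * \<theta>) ^ 2 + n * \<theta> * (1 - 6 * \<theta>)"
proof (induction n)
  case (Suc n)
  have c: "(4::nat) choose 2 = 6" by code_simp
  have "binomial_cmoment 4 (Suc n) p = binomial_cmoment 4 n p
     + 6 * binomial_cmoment 2 n p * \<theta> + \<theta> * (1 - 3 * \<theta>)"
    unfolding cmoment_rec
    by (simp add: atMost_nat_numeral binomial_cmoment_1 step_moment_values atMost_Suc c)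
  with Suc show ?case by (simp add: binomial_cmoment_2 algebra_simps power2_eq_square)
qed (simp add: binomial_cmoment_0n[OF p])

text \<open>The bound is the sixth central moment of a Poisson variable with mean
  \<open>n * \<theta>\<close>; the exact binomial moment differs from it only by nonpositive
  corrections in \<theta>. The recursion preserves this bound.\<close>

lemma binomial_cmoment_6_le: "binomial_cmoment 6 n p \<le> 15 * (n * \<theta>) ^ 3 + 25 * (n * \<theta>) ^ 2 + n * \<theta>"
proof (induction n)
  case (Suc n)
  have th: "0 \<le> \<theta>" "\<theta> \<le> 1 / 4" using p mult_one_minus_le_quarter[of p] by (simp_all add: \<theta>)
  define m where "m = real n * \<theta>"
  have m: "m \<ge> 0" using th by (simp add: m_def)
  have c: "(6::nat) choose 2 = 15" "(6::nat) choose 3 = 20" "(6::nat) choose 4 = 15" by code_simp+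
  have rec: "binomial_cmoment 6 (Suc n) p = binomial_cmoment 6 n p + 15 * binomial_cmoment 4 n p * \<theta>
     + 20 * binomial_cmoment 3 n p * (\<theta> * (1 - 2 * p)) + 15 * binomial_cmoment 2 n p * (\<theta> * (1 - 3 * \<theta>))
     + \<theta> * (1 - 5 * \<theta> + 5 * \<theta> ^ 2)"
    unfolding cmoment_rec
    by (simp add: atMost_nat_numeral binomial_cmoment_1 step_moment_values atMost_Suc c)
  have q: "(1 - 2 * p) ^ 2 = 1 - 4 * \<theta>" by (simp add: \<theta> power2_eq_square algebra_simps)
  have "binomial_cmoment 6 (Suc n) p \<le> 15 * m ^ 3 + 25 * m ^ 2 + m + 15 * (3 * m ^ 2 + m * (1 - 6 * \<theta>)) * \<theta>
     + 20 * m * \<theta> * (1 - 2 * p) ^ 2 + 15 * m * (\<theta> * (1 - 3 * \<theta>)) + \<theta> * (1 - 5 * \<theta> + 5 * \<theta> ^ 2)"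
    using Suc.IH unfolding rec binomial_cmoment_4 binomial_cmoment_3 binomial_cmoment_2 m_def[symmetric]
    by (simp add: power2_eq_square algebra_simps)
  also have "\<dots> = 15 * m ^ 3 + 25 * m ^ 2 + m + 45 * m ^ 2 * \<theta> + 50 * m * \<theta> + \<theta>
      - 215 * m * \<theta> ^ 2 - 5 * \<theta> ^ 2 * (1 - \<theta>)"
    unfolding q by (simp add: power2_eq_square algebra_simps)
  also have "\<dots> \<le> 15 * m ^ 3 + 25 * m ^ 2 + m + 45 * m ^ 2 * \<theta> + 50 * m * \<theta> + \<theta>"
  proof -
    have "0 \<le> m * \<theta> ^ 2" "0 \<le> \<theta> ^ 2 * (1 - \<theta>)" using m th by auto
    then show ?thesis unfolding mult.assoc by linarith
  qed
  \<comment> \<open>Expanding the right-hand side reproduces every term on the left exactly; only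
    nonnegative multiples of \<open>m * \<theta> ^ 2\<close>, \<open>\<theta> ^ 3\<close> and
    \<open>\<theta> ^ 2\<close> are left over.\<close>
  also have "\<dots> \<le> 15 * (m + \<theta>) ^ 3 + 25 * (m + \<theta>) ^ 2 + (m + \<theta>)"
  proof -
    have "0 \<le> m * \<theta> ^ 2" "0 \<le> \<theta> ^ 3" "0 \<le> \<theta> ^ 2" using m th by auto
    then show ?thesis by (simp add: power2_eq_square power3_eq_cube algebra_simps)
  qed
  also have "m + \<theta> = real (Suc n) * \<theta>" by (simp add: m_def algebra_simps)
  finally show ?case .
qed (simp add: binomial_cmoment_0n[OF p])

end

section \<open>Lyapunov's theorem and studentization\<close>

text \<open>The last claim is the moment inequality between the second and third absolute moments,
  multiplied by the standard deviation so that nothing is divided by a variance that may vanish. It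
  later absorbs squared variances into third moments.\<close>

lemma (in prob_space) abs_moments_le:
  fixes X :: "'a \<Rightarrow> real"
  assumes [measurable]: "random_variable borel X" and int: "integrable M (\<lambda>x. \<bar>X x\<bar> ^ 3)"
  shows "integrable M X" "integrable M (\<lambda>x. X x ^ 2)"
    and "expectation (\<lambda>x. X x ^ 2) ^ 2
           \<le> sqrt (expectation (\<lambda>x. X x ^ 2)) * expectation (\<lambda>x. \<bar>X x\<bar> ^ 3)"
proof -
  have pw: "x ^ 2 \<le> 1 + \<bar>x\<bar> ^ 3" for x :: real
  proof (cases "\<bar>x\<bar> \<le> 1")
    case True
    then have "x ^ 2 \<le> 1" by (simp add: abs_square_le_1)
    then show ?thesis by (smt (verit) zero_le_power abs_ge_zero)
  next
    case False
    then have "\<bar>x\<bar> ^ 2 \<le> \<bar>x\<bar> ^ 3" by (intro power_increasing) auto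
    then show ?thesis by simp
  qed
  show sq: "integrable M (\<lambda>x. X x ^ 2)"
    by (rule Bochner_Integration.integrable_bound[where f="\<lambda>x. 1 + \<bar>X x\<bar> ^ 3"])
      (use int pw in \<open>auto intro!: AE_I2\<close>)
  show X: "integrable M X"
    by (rule square_integrable_imp_integrable[OF _ sq]) simp
  define v where "v = expectation (\<lambda>x. X x ^ 2)"
  define r where "r = expectation (\<lambda>x. \<bar>X x\<bar> ^ 3)"
  have v0: "v \<ge> 0" unfolding v_def by simp
  define s where "s = sqrt v"
  have s: "s \<ge> 0" "s ^ 2 = v" using v0 by (auto simp: s_def)
  have pos: "variance (\<lambda>x. \<bar>X x\<bar>) \<ge> 0" by (rule variance_positive)
  have "variance (\<lambda>x. \<bar>X x\<bar>) = v - (expectation (\<lambda>x. \<bar>X x\<bar>)) ^ 2"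
    using X sq by (subst variance_eq) (auto simp: v_def)
  with pos have "(expectation (\<lambda>x. \<bar>X x\<bar>)) ^ 2 \<le> s ^ 2"
    by (simp add: s)
  then have a: "expectation (\<lambda>x. \<bar>X x\<bar>) \<le> s" using s(1) by (rule power2_le_imp_le)
  \<comment> \<open>Here \<open>s\<close> is the L2 norm of \<open>X\<close>. Integrating
    \<open>\<bar>x\<bar> * (\<bar>x\<bar> - s) ^ 2 \<ge> 0\<close> and using that the mean of
    \<open>\<bar>X\<bar>\<close> is at most \<open>s\<close> takes the place of Holder's
    inequality.\<close>
  have "2 * s * X x ^ 2 \<le> s ^ 2 * \<bar>X x\<bar> + \<bar>X x\<bar> ^ 3" for x
  proof -
    have "0 \<le> \<bar>X x\<bar> * (\<bar>X x\<bar> - s) ^ 2" by simp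
    also have "\<dots> = s ^ 2 * \<bar>X x\<bar> + \<bar>X x\<bar> ^ 3 - 2 * s * \<bar>X x\<bar> ^ 2"
      by (simp add: power2_eq_square power3_eq_cube algebra_simps)
    finally show ?thesis by simp
  qed
  then have "expectation (\<lambda>x. 2 * s * X x ^ 2) \<le> expectation (\<lambda>x. s ^ 2 * \<bar>X x\<bar> + \<bar>X x\<bar> ^ 3)"
    using X sq int by (intro integral_mono) auto
  then have "2 * s * v \<le> s ^ 2 * expectation (\<lambda>x. \<bar>X x\<bar>) + r"
    using X sq int by (simp add: v_def r_def)
  also have "\<dots> \<le> s ^ 2 * s + r" using a by (intro add_right_mono mult_left_mono) auto
  finally have "s * s ^ 2 \<le> r" unfolding s(2)[symmetric] by (simp add: algebra_simps)
  then have "s * (s * s ^ 2) \<le> s * r" using s(1) by (rule mult_left_mono)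
  moreover have "s * (s * s ^ 2) = v ^ 2"
    unfolding s(2)[symmetric] by (simp add: power2_eq_square algebra_simps)
  ultimately show "v ^ 2 \<le> sqrt v * r" by (simp add: s_def)
qed

lemma exp_minus_approx:
  fixes a :: real
  assumes "a \<ge> 0"
  shows "\<bar>exp (- a) - (1 - a)\<bar> \<le> a ^ 2 / 2"
proof -
  have "1 - a \<le> exp (- a)" using exp_ge_add_one_self[of "- a"] by simp
  moreover have "exp (- a) \<le> 1 - a + a ^ 2 / 2"
  proof -
    have "1 + a + a ^ 2 / 2 \<le> exp a" using assms by (rule exp_lower_Taylor_quadratic)
    \<comment> \<open>The product equals \<open>1 + a ^ 4 / 4\<close>.\<close>
    moreover have "1 \<le> (1 - a + a ^ 2 / 2) * (1 + a + a ^ 2 / 2)"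
      using zero_le_power[OF assms, of 4]
      by (simp add: algebra_simps eval_nat_numeral)
    moreover have "0 \<le> 1 - a + a ^ 2 / 2"
      using zero_le_power2[of "1 - a"] by (simp add: power2_diff)
    ultimately have "1 \<le> (1 - a + a ^ 2 / 2) * exp a"
      by (meson mult_left_mono order_trans)
    then show ?thesis by (simp add: exp_minus field_simps)
  qed
  ultimately show ?thesis by simp
qed

text \<open>Both terms are products of factors of modulus at most 1, so their distance is at most
  the sum of the factorwise distances; each pair of factors is compared through the common Taylor
  polynomial \<open>1 - t ^ 2 * w i / 2\<close>. The bound is explicit, so the space may vary with
  the row.\<close>

lemma (in prob_space) char_sum_approx:
  fixes X :: "'i \<Rightarrow> 'a \<Rightarrow> real"
  assumes fin: "finite I" and indep: "indep_vars (\<lambda>_. borel) X I"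
    and int: "\<And>i. i \<in> I \<Longrightarrow> integrable M (\<lambda>x. \<bar>X i x\<bar> ^ 3)"
    and mean: "\<And>i. i \<in> I \<Longrightarrow> expectation (X i) = 0"
  defines "v \<equiv> \<Sum>i\<in>I. expectation (\<lambda>x. X i x ^ 2)"
    and "\<rho> \<equiv> \<Sum>i\<in>I. expectation (\<lambda>x. \<bar>X i x\<bar> ^ 3)"
  shows "cmod (char (distr M borel (\<lambda>x. \<Sum>i\<in>I. X i x)) t - exp (- (t ^ 2 * v / 2)))
           \<le> (\<bar>t\<bar> ^ 3 / 6 + t ^ 4 * sqrt v / 8) * \<rho>"
proof -
  define w where "w i = expectation (\<lambda>x. X i x ^ 2)" for i
  define q where "q i = expectation (\<lambda>x. \<bar>X i x\<bar> ^ 3)" for i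
  have w0: "w i \<ge> 0" and q0: "q i \<ge> 0" for i by (auto simp: w_def q_def)
  have rv: "random_variable borel (X i)" if "i \<in> I" for i
    using indep that by (auto simp: indep_vars_def)
  have wv: "w i \<le> v" if "i \<in> I" for i
    unfolding v_def w_def[symmetric] using that fin w0 by (intro member_le_sum) auto
  have term_le: "cmod (char (distr M borel (X i)) t - exp (- (t ^ 2 * w i / 2)))
     \<le> (\<bar>t\<bar> ^ 3 / 6 + t ^ 4 * sqrt v / 8) * q i" if i: "i \<in> I" for i
  proof -
    note m = abs_moments_le[OF rv[OF i] int[OF i]]
    have "cmod (char (distr M borel (X i)) t - (1 - t ^ 2 * w i / 2))
      \<le> (t ^ 2 / 6) * expectation (\<lambda>x. min (6 * (X i x) ^ 2) (\<bar>t\<bar> * \<bar>X i x\<bar> ^ 3))"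
      by (rule char_approx3') (use m rv[OF i] mean[OF i] in \<open>auto simp: w_def\<close>)
    also have "\<dots> \<le> (t ^ 2 / 6) * expectation (\<lambda>x. \<bar>t\<bar> * \<bar>X i x\<bar> ^ 3)"
      using m(2) int[OF i] by (intro mult_left_mono integral_mono) auto
    also have "\<dots> = \<bar>t\<bar> ^ 3 / 6 * q i"
      by (simp add: q_def power3_eq_cube power2_eq_square abs_mult_self)
    finally have 1: "cmod (char (distr M borel (X i)) t - (1 - t ^ 2 * w i / 2)) \<le> \<bar>t\<bar> ^ 3 / 6 * q i" .
    have "\<bar>exp (- (t ^ 2 * w i / 2)) - (1 - t ^ 2 * w i / 2)\<bar> \<le> (t ^ 2 * w i / 2) ^ 2 / 2"
      by (rule exp_minus_approx) (simp add: w0)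
    also have "\<dots> = t ^ 4 / 8 * (w i) ^ 2" by (simp add: power_mult_distrib power_divide)
    \<comment> \<open>The error of the Gaussian factor is quadratic in the variance
      \<open>w i\<close>; the moment inequality makes it linear in the third moment
      \<open>q i\<close>, which can be summed to \<rho>.\<close>
    also have "\<dots> \<le> t ^ 4 / 8 * (sqrt v * q i)"
    proof (intro mult_left_mono)
      have "(w i) ^ 2 \<le> sqrt (w i) * q i" using m(3) by (simp add: w_def q_def)
      also have "\<dots> \<le> sqrt v * q i" using wv[OF i] q0 by (intro mult_right_mono) auto
      finally show "(w i) ^ 2 \<le> sqrt v * q i" .
    qed auto
    finally have 2: "cmod (exp (- (t ^ 2 * w i / 2)) - (1 - t ^ 2 * w i / 2)) \<le> t ^ 4 / 8 * (sqrt v * q i)"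
      by (simp only: of_real_diff[symmetric] norm_of_real)
    show ?thesis using norm_triangle_le_diff[OF add_mono[OF 1 2]]
      by (simp add: algebra_simps)
  qed
  have ex: "complex_of_real (exp (- (t ^ 2 * v / 2))) = (\<Prod>i\<in>I. complex_of_real (exp (- (t ^ 2 * w i / 2))))"
    using fin by (simp add: v_def w_def[symmetric] exp_sum[symmetric] sum_distrib_left sum_divide_distrib sum_negf
      flip: of_real_prod)
  have "cmod (char (distr M borel (\<lambda>x. \<Sum>i\<in>I. X i x)) t - exp (- (t ^ 2 * v / 2)))
     = cmod ((\<Prod>i\<in>I. char (distr M borel (X i)) t) - (\<Prod>i\<in>I. complex_of_real (exp (- (t ^ 2 * w i / 2)))))"
    unfolding ex char_distr_sum[OF indep] ..
  also have "\<dots> \<le> (\<Sum>i\<in>I. cmod (char (distr M borel (X i)) t - complex_of_real (exp (- (t ^ 2 * w i / 2)))))"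
    using w0 rv by (intro norm_prod_diff real_distribution.cmod_char_le_1 real_distribution_distr) auto
  also have "\<dots> \<le> (\<Sum>i\<in>I. (\<bar>t\<bar> ^ 3 / 6 + t ^ 4 * sqrt v / 8) * q i)"
    by (intro sum_mono term_le)
  also have "\<dots> = (\<bar>t\<bar> ^ 3 / 6 + t ^ 4 * sqrt v / 8) * \<rho>"
    by (simp add: \<rho>_def q_def sum_distrib_left)
  finally show ?thesis .
qed

text \<open>For fixed \<open>t\<close> the bound of \<open>char_sum_approx\<close> vanishes in the
  limit, and Levy's continuity theorem applies. The row variances need only tend to 1, which permits
  normalizing by the leading term of the standard deviation.\<close>

theorem lyapunov_central_limit:
  fixes M :: "nat \<Rightarrow> 'a measure" and X :: "nat \<Rightarrow> 'i \<Rightarrow> 'a \<Rightarrow> real" and I :: "nat \<Rightarrow> 'i set"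
  assumes prob: "\<And>k. prob_space (M k)"
    and fin: "\<And>k. finite (I k)"
    and indep: "\<And>k. prob_space.indep_vars (M k) (\<lambda>_. borel) (X k) (I k)"
    and int: "\<And>k i. i \<in> I k \<Longrightarrow> integrable (M k) (\<lambda>x. \<bar>X k i x\<bar> ^ 3)"
    and mean: "\<And>k i. i \<in> I k \<Longrightarrow> (\<integral>x. X k i x \<partial>M k) = 0"
    and var: "(\<lambda>k. \<Sum>i\<in>I k. \<integral>x. X k i x ^ 2 \<partial>M k) \<longlonglongrightarrow> 1"
    and third: "(\<lambda>k. \<Sum>i\<in>I k. \<integral>x. \<bar>X k i x\<bar> ^ 3 \<partial>M k) \<longlonglongrightarrow> 0"
  shows "weak_conv_m (\<lambda>k. distr (M k) borel (\<lambda>x. \<Sum>i\<in>I k. X k i x)) std_normal_distribution"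
proof (rule levy_continuity)
  fix k
  interpret prob_space "M k" by (rule prob)
  have "X k i \<in> borel_measurable (M k)" if "i \<in> I k" for i
    using indep[of k] that by (auto simp: indep_vars_def)
  then show "real_distribution (distr (M k) borel (\<lambda>x. \<Sum>i\<in>I k. X k i x))"
    by (intro real_distribution_distr borel_measurable_sum)
next
  fix t :: real
  define v where "v k = (\<Sum>i\<in>I k. \<integral>x. X k i x ^ 2 \<partial>M k)" for k
  define \<rho> where "\<rho> k = (\<Sum>i\<in>I k. \<integral>x. \<bar>X k i x\<bar> ^ 3 \<partial>M k)" for k
  let ?c = "\<lambda>k. char (distr (M k) borel (\<lambda>x. \<Sum>i\<in>I k. X k i x)) t"
  have le: "cmod (?c k - exp (- (t ^ 2 * v k / 2))) \<le> (\<bar>t\<bar> ^ 3 / 6 + t ^ 4 * sqrt (v k) / 8) * \<rho> k" for k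
    unfolding v_def \<rho>_def
    by (rule prob_space.char_sum_approx[OF prob fin indep int mean])
  have v: "v \<longlonglongrightarrow> 1" and \<rho>: "\<rho> \<longlonglongrightarrow> 0"
    using var third unfolding v_def[abs_def] \<rho>_def[abs_def] by simp_all
  have "(\<lambda>k. (\<bar>t\<bar> ^ 3 / 6 + t ^ 4 * sqrt (v k) / 8) * \<rho> k) \<longlonglongrightarrow> (\<bar>t\<bar> ^ 3 / 6 + t ^ 4 * sqrt 1 / 8) * 0"
    by (intro tendsto_intros v \<rho>) auto
  then have "(\<lambda>k. ?c k - exp (- (t ^ 2 * v k / 2))) \<longlonglongrightarrow> 0"
    by (intro Lim_null_comparison[OF always_eventually[OF allI[OF le]]]) simp
  moreover have "(\<lambda>k. complex_of_real (exp (- (t ^ 2 * v k / 2)))) \<longlonglongrightarrow> complex_of_real (exp (- (t ^ 2 * 1 / 2)))"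
    by (intro tendsto_intros v) auto
  ultimately have "?c \<longlonglongrightarrow> complex_of_real (exp (- (t ^ 2 * 1 / 2)))"
    by (rule Lim_transform[rotated])
  then show "?c \<longlonglongrightarrow> char std_normal_distribution t"
    by (simp add: char_std_normal_distribution)
qed (rule real_dist_normal_dist)

section \<open>Weak convergence of statistics that are close in probability\<close>

lemma isCont_cdf_std_normal: "isCont (cdf std_normal_distribution) x"
proof -
  interpret real_distribution std_normal_distribution by (rule real_dist_normal_dist)
  have "emeasure std_normal_distribution {x} = 0"
    by (subst emeasure_density) (auto simp: nn_integral_null_set)
  then show ?thesis by (simp add: isCont_cdf measure_def)
qed

text \<open>For \<epsilon> < 1 the maps \<open>u + \<epsilon> * (1 + \<bar>u\<bar>)\<close> and
  \<open>u - \<epsilon> * (1 + \<bar>u\<bar>)\<close> are increasing in \<open>u\<close>. Off the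
  exceptional event, a bound \<open>W \<le> x\<close> therefore gives
  \<open>S \<le> x + \<epsilon> * (1 + \<bar>x\<bar>)\<close>, and similarly from below, so the
  distribution function of \<open>W\<close> is squeezed between shifts of that of
  \<open>S\<close>.\<close>

lemma weak_conv_m_close:
  fixes M :: "nat \<Rightarrow> 'a measure" and S W :: "nat \<Rightarrow> 'a \<Rightarrow> real"
  assumes prob: "\<And>k. prob_space (M k)"
    and S: "\<And>k. S k \<in> borel_measurable (M k)" and W: "\<And>k. W k \<in> borel_measurable (M k)"
    and conv: "weak_conv_m (\<lambda>k. distr (M k) borel (S k)) \<mu>"
    and cont: "\<And>x. isCont (cdf \<mu>) x"
    and close: "\<And>\<epsilon>. 0 < \<epsilon> \<Longrightarrow> \<epsilon> < 1 \<Longrightarrow>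
      (\<lambda>k. measure (M k) {\<omega> \<in> space (M k). \<not> \<bar>S k \<omega> - W k \<omega>\<bar> \<le> \<epsilon> * (1 + \<bar>W k \<omega>\<bar>)}) \<longlonglongrightarrow> 0"
  shows "weak_conv_m (\<lambda>k. distr (M k) borel (W k)) \<mu>"
  unfolding weak_conv_m_def weak_conv_def
proof (intro allI impI)
  fix x :: real
  define F where "F k y = measure (M k) {\<omega> \<in> space (M k). S k \<omega> \<le> y}" for k y
  define G where "G k y = measure (M k) {\<omega> \<in> space (M k). W k \<omega> \<le> y}" for k y
  define b where "b \<epsilon> k = measure (M k) {\<omega> \<in> space (M k). \<not> \<bar>S k \<omega> - W k \<omega>\<bar> \<le> \<epsilon> * (1 + \<bar>W k \<omega>\<bar>)}" for \<epsilon> k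
  have cdfF: "cdf (distr (M k) borel (S k)) y = F k y" for k y
    unfolding cdf_def F_def using S[of k] by (simp add: measure_distr vimage_def Int_def conj_commute)
  have cdfG: "cdf (distr (M k) borel (W k)) y = G k y" for k y
    unfolding cdf_def G_def using W[of k] by (simp add: measure_distr vimage_def Int_def conj_commute)
  have F: "(\<lambda>k. F k y) \<longlonglongrightarrow> cdf \<mu> y" for y
    using conv cont unfolding weak_conv_m_def weak_conv_def cdfF by simp
  define c where "c = 1 + \<bar>x\<bar>"
  have mono: "u + \<epsilon> * (1 + \<bar>u\<bar>) \<le> v + \<epsilon> * (1 + \<bar>v\<bar>)" "u - \<epsilon> * (1 + \<bar>u\<bar>) \<le> v - \<epsilon> * (1 + \<bar>v\<bar>)"
    if "u \<le> v" "0 < \<epsilon>" "\<epsilon> < 1" for u v \<epsilon> :: real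
  proof -
    have "\<epsilon> * \<bar>\<bar>v\<bar> - \<bar>u\<bar>\<bar> \<le> 1 * (v - u)"
      using that by (intro mult_mono) auto
    then have "\<bar>\<epsilon> * (\<bar>v\<bar> - \<bar>u\<bar>)\<bar> \<le> v - u" using that by (simp add: abs_mult)
    then have "\<bar>\<epsilon> * \<bar>v\<bar> - \<epsilon> * \<bar>u\<bar>\<bar> \<le> v - u" by (simp add: algebra_simps)
    then show "u + \<epsilon> * (1 + \<bar>u\<bar>) \<le> v + \<epsilon> * (1 + \<bar>v\<bar>)" "u - \<epsilon> * (1 + \<bar>u\<bar>) \<le> v - \<epsilon> * (1 + \<bar>v\<bar>)"
      by (auto simp: distrib_left)
  qed
  have upper: "G k x \<le> F k (x + \<epsilon> * c) + b \<epsilon> k" and lower: "F k (x - \<epsilon> * c) \<le> G k x + b \<epsilon> k"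
    if \<epsilon>: "0 < \<epsilon>" "\<epsilon> < 1" for k \<epsilon>
  proof -
    interpret prob_space "M k" by (rule prob)
    note [measurable] = S[of k] W[of k]
    let ?B = "{\<omega> \<in> space (M k). \<not> \<bar>S k \<omega> - W k \<omega>\<bar> \<le> \<epsilon> * (1 + \<bar>W k \<omega>\<bar>)}"
    have "G k x \<le> measure (M k) ({\<omega> \<in> space (M k). S k \<omega> \<le> x + \<epsilon> * c} \<union> ?B)"
      unfolding G_def
    proof (intro finite_measure_mono subsetI)
      fix \<omega> assume "\<omega> \<in> {\<omega> \<in> space (M k). W k \<omega> \<le> x}"
      then show "\<omega> \<in> {\<omega> \<in> space (M k). S k \<omega> \<le> x + \<epsilon> * c} \<union> ?B"
        using mono(1)[OF _ \<epsilon>, of "W k \<omega>" x] by (auto simp: c_def)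
    qed measurable
    also have "\<dots> \<le> F k (x + \<epsilon> * c) + b \<epsilon> k"
      unfolding F_def b_def by (intro measure_Un_le) measurable
    finally show "G k x \<le> F k (x + \<epsilon> * c) + b \<epsilon> k" .
    have "F k (x - \<epsilon> * c) \<le> measure (M k) ({\<omega> \<in> space (M k). W k \<omega> \<le> x} \<union> ?B)"
      unfolding F_def
    proof (intro finite_measure_mono subsetI)
      fix \<omega> assume *: "\<omega> \<in> {\<omega> \<in> space (M k). S k \<omega> \<le> x - \<epsilon> * c}"
      show "\<omega> \<in> {\<omega> \<in> space (M k). W k \<omega> \<le> x} \<union> ?B"
      proof (cases "W k \<omega> \<le> x")
        case False
        have "\<not> \<bar>S k \<omega> - W k \<omega>\<bar> \<le> \<epsilon> * (1 + \<bar>W k \<omega>\<bar>)"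
        proof
          assume a: "\<bar>S k \<omega> - W k \<omega>\<bar> \<le> \<epsilon> * (1 + \<bar>W k \<omega>\<bar>)"
          \<comment> \<open>The facts \<open>mono\<close> are not strict; the midpoint
            \<open>z\<close>, strictly above \<open>x\<close>, supplies the strict inequality that
            contradicts \<open>S k \<omega> \<le> x - \<epsilon> * c\<close>.\<close>
          define z where "z = (x + W k \<omega>) / 2"
          have "z - \<epsilon> * (1 + \<bar>z\<bar>) \<le> W k \<omega> - \<epsilon> * (1 + \<bar>W k \<omega>\<bar>)"
            using False by (intro mono(2) \<epsilon>) (simp add: z_def)
          moreover have "x - \<epsilon> * (1 + \<bar>x\<bar>) < z - \<epsilon> * (1 + \<bar>z\<bar>)"
          proof -
            have "\<epsilon> * (\<bar>z\<bar> - \<bar>x\<bar>) \<le> \<epsilon> * (z - x)" using False \<epsilon> by (intro mult_left_mono) (auto simp: z_def)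
            also have "\<dots> < 1 * (z - x)" using False \<epsilon> by (intro mult_strict_right_mono) (auto simp: z_def)
            finally show ?thesis by (simp add: algebra_simps)
          qed
          ultimately show False using a * by (auto simp: c_def)
        qed
        with * show ?thesis by auto
      qed (use * in auto)
    qed measurable
    also have "\<dots> \<le> G k x + b \<epsilon> k"
      unfolding G_def b_def by (intro measure_Un_le) measurable
    finally show "F k (x - \<epsilon> * c) \<le> G k x + b \<epsilon> k" .
  qed
  have "(\<lambda>k. G k x) \<longlonglongrightarrow> cdf \<mu> x"
    unfolding tendsto_iff dist_real_def
  proof (intro allI impI)
    fix e :: real assume e: "e > 0"
    \<comment> \<open>First \<epsilon> is fixed by continuity of the limit at \<open>x\<close>, and
      only then does \<open>k\<close> grow. The shift, the convergence of \<open>F\<close> and the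
      exceptional event cost \<open>e / 3\<close> each.\<close>
    have "((\<lambda>\<epsilon>. cdf \<mu> (x + \<epsilon> * c)) \<longlongrightarrow> cdf \<mu> (x + 0 * c)) (at_right 0)"
      by (rule isCont_tendsto_compose[OF cont]) (intro tendsto_intros)
    from tendstoD[OF this, of "e / 3"]
    have "\<forall>\<^sub>F \<epsilon> in at_right 0. \<bar>cdf \<mu> (x + \<epsilon> * c) - cdf \<mu> x\<bar> < e / 3"
      using e by (simp add: dist_real_def)
    moreover have "((\<lambda>\<epsilon>. cdf \<mu> (x - \<epsilon> * c)) \<longlongrightarrow> cdf \<mu> (x - 0 * c)) (at_right 0)"
      by (rule isCont_tendsto_compose[OF cont]) (intro tendsto_intros)
    from tendstoD[OF this, of "e / 3"]
    have "\<forall>\<^sub>F \<epsilon> in at_right 0. \<bar>cdf \<mu> (x - \<epsilon> * c) - cdf \<mu> x\<bar> < e / 3"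
      using e by (simp add: dist_real_def)
    moreover have "\<forall>\<^sub>F \<epsilon>::real in at_right 0. 0 < \<epsilon> \<and> \<epsilon> < 1"
      by (auto intro: eventually_at_rightI[of 0 1])
    ultimately have "\<forall>\<^sub>F \<epsilon> in at_right 0. \<bar>cdf \<mu> (x + \<epsilon> * c) - cdf \<mu> x\<bar> < e / 3
        \<and> \<bar>cdf \<mu> (x - \<epsilon> * c) - cdf \<mu> x\<bar> < e / 3 \<and> 0 < \<epsilon> \<and> \<epsilon> < 1"
      by eventually_elim auto
    then obtain \<epsilon> where \<epsilon>: "\<bar>cdf \<mu> (x + \<epsilon> * c) - cdf \<mu> x\<bar> < e / 3"
        "\<bar>cdf \<mu> (x - \<epsilon> * c) - cdf \<mu> x\<bar> < e / 3" "0 < \<epsilon>" "\<epsilon> < 1"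
      using eventually_happens'[OF trivial_limit_at_right_real] by blast
    have "\<forall>\<^sub>F k in sequentially. \<bar>F k (x + \<epsilon> * c) - cdf \<mu> (x + \<epsilon> * c)\<bar> < e / 3"
      "\<forall>\<^sub>F k in sequentially. \<bar>F k (x - \<epsilon> * c) - cdf \<mu> (x - \<epsilon> * c)\<bar> < e / 3"
      using tendstoD[OF F, of "e / 3"] e by (simp_all add: dist_real_def)
    moreover have "\<forall>\<^sub>F k in sequentially. \<bar>b \<epsilon> k\<bar> < e / 3"
      using tendstoD[OF close[OF \<epsilon>(3,4)], of "e / 3"] e by (simp add: dist_real_def b_def)
    ultimately show "\<forall>\<^sub>F k in sequentially. \<bar>G k x - cdf \<mu> x\<bar> < e"
    proof eventually_elim
      case (elim k)
      then show ?case using \<epsilon>(1,2) upper[OF \<epsilon>(3,4), of k] lower[OF \<epsilon>(3,4), of k] by linarith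
    qed
  qed
  then show "(\<lambda>k. cdf (distr (M k) borel (W k)) x) \<longlonglongrightarrow> cdf \<mu> x"
    by (simp add: cdfG)
qed

lemma (in prob_space) prob_gt_le_expectation_abs:
  fixes X :: "'a \<Rightarrow> real"
  assumes "integrable M X" and "\<epsilon> > 0"
  shows "prob {\<omega> \<in> space M. \<epsilon> < \<bar>X \<omega>\<bar>} \<le> expectation (\<lambda>\<omega>. \<bar>X \<omega>\<bar>) / \<epsilon>"
proof -
  note [measurable] = borel_measurable_integrable[OF assms(1)]
  have "prob {\<omega> \<in> space M. \<epsilon> < \<bar>X \<omega>\<bar>} \<le> prob {\<omega> \<in> space M. \<epsilon> \<le> \<bar>X \<omega>\<bar>}"
    by (intro finite_measure_mono) auto
  also have "\<dots> \<le> expectation (\<lambda>\<omega>. \<bar>X \<omega>\<bar>) / \<epsilon>"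
    by (rule integral_Markov_inequality_measure[where A="{}"]) (use assms in auto)
  finally show ?thesis .
qed

text \<open>A form of Slutsky's theorem that never uses tightness: off a set of small probability,
  \<open>S = W \<surd>V - R\<close> is close to \<open>W\<close> relative to \<open>1 + \<bar>W\<bar>\<close>.\<close>

lemma weak_conv_m_studentized:
  fixes M :: "nat \<Rightarrow> 'a measure" and S R V W :: "nat \<Rightarrow> 'a \<Rightarrow> real"
  assumes prob: "\<And>k. prob_space (M k)"
    and S: "\<And>k. S k \<in> borel_measurable (M k)" and W: "\<And>k. W k \<in> borel_measurable (M k)"
    and R: "\<And>k. integrable (M k) (R k)" and V: "\<And>k. integrable (M k) (V k)"
    and conv: "weak_conv_m (\<lambda>k. distr (M k) borel (S k)) \<mu>"
    and cont: "\<And>x. isCont (cdf \<mu>) x"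
    and R0: "(\<lambda>k. \<integral>\<omega>. \<bar>R k \<omega>\<bar> \<partial>M k) \<longlonglongrightarrow> 0"
    and V1: "(\<lambda>k. \<integral>\<omega>. \<bar>V k \<omega> - 1\<bar> \<partial>M k) \<longlonglongrightarrow> 0"
    and eq: "\<And>k \<omega>. \<omega> \<in> space (M k) \<Longrightarrow> V k \<omega> > 0 \<Longrightarrow> W k \<omega> = (S k \<omega> + R k \<omega>) / sqrt (V k \<omega>)"
  shows "weak_conv_m (\<lambda>k. distr (M k) borel (W k)) \<mu>"
proof (rule weak_conv_m_close[OF prob S W conv cont])
  fix \<epsilon> :: real assume \<epsilon>: "0 < \<epsilon>" "\<epsilon> < 1"
  let ?B = "\<lambda>k. {\<omega> \<in> space (M k). \<not> \<bar>S k \<omega> - W k \<omega>\<bar> \<le> \<epsilon> * (1 + \<bar>W k \<omega>\<bar>)}"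
  have le: "measure (M k) (?B k) \<le> (\<integral>\<omega>. \<bar>R k \<omega>\<bar> \<partial>M k) / \<epsilon> + (\<integral>\<omega>. \<bar>V k \<omega> - 1\<bar> \<partial>M k) / \<epsilon>" for k
  proof -
    interpret prob_space "M k" by (rule prob)
    note [measurable] = borel_measurable_integrable[OF R[of k]] borel_measurable_integrable[OF V[of k]]
    have "prob (?B k) \<le> prob ({\<omega> \<in> space (M k). \<epsilon> < \<bar>R k \<omega>\<bar>} \<union> {\<omega> \<in> space (M k). \<epsilon> < \<bar>V k \<omega> - 1\<bar>})"
    proof (intro finite_measure_mono subsetI)
      fix \<omega> assume \<omega>: "\<omega> \<in> ?B k"
      show "\<omega> \<in> {\<omega> \<in> space (M k). \<epsilon> < \<bar>R k \<omega>\<bar>} \<union> {\<omega> \<in> space (M k). \<epsilon> < \<bar>V k \<omega> - 1\<bar>}"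
      proof (rule ccontr)
        assume "\<not> ?thesis"
        then have r: "\<bar>R k \<omega>\<bar> \<le> \<epsilon>" and v: "\<bar>V k \<omega> - 1\<bar> \<le> \<epsilon>" using \<omega> by auto
        define s where "s = sqrt (V k \<omega>)"
        have V0: "V k \<omega> > 0" using v \<epsilon> by auto
        then have s: "s > 0" "s ^ 2 = V k \<omega>" by (auto simp: s_def)
        \<comment> \<open>Since \<open>s + 1 \<ge> 1\<close>, the deviation of the square root from
          1 is at most that of \<open>V\<close> itself.\<close>
        have "\<bar>s - 1\<bar> * 1 \<le> \<bar>s - 1\<bar> * (s + 1)" using s by (intro mult_left_mono) auto
        also have "\<dots> = \<bar>(s - 1) * (s + 1)\<bar>" using s by (simp add: abs_mult)
        also have "(s - 1) * (s + 1) = s ^ 2 - 1" by (simp add: algebra_simps power2_eq_square)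
        finally have s1: "\<bar>s - 1\<bar> \<le> \<epsilon>" using v s by simp
        have "W k \<omega> = (S k \<omega> + R k \<omega>) / s" using eq[of \<omega> k] \<omega> V0 by (simp add: s_def)
        then have "S k \<omega> - W k \<omega> = W k \<omega> * (s - 1) - R k \<omega>" using s by (simp add: field_simps)
        then have "\<bar>S k \<omega> - W k \<omega>\<bar> \<le> \<bar>W k \<omega>\<bar> * \<bar>s - 1\<bar> + \<bar>R k \<omega>\<bar>"
          by (metis abs_mult abs_triangle_ineq4)
        also have "\<dots> \<le> \<bar>W k \<omega>\<bar> * \<epsilon> + \<epsilon>" using s1 r by (intro add_mono mult_left_mono) auto
        finally show False using \<omega> by (auto simp: algebra_simps)
      qed
    qed measurable
    also have "\<dots> \<le> prob {\<omega> \<in> space (M k). \<epsilon> < \<bar>R k \<omega>\<bar>} + prob {\<omega> \<in> space (M k). \<epsilon> < \<bar>V k \<omega> - 1\<bar>}"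
      by (intro measure_Un_le) measurable
    also have "\<dots> \<le> (\<integral>\<omega>. \<bar>R k \<omega>\<bar> \<partial>M k) / \<epsilon> + (\<integral>\<omega>. \<bar>V k \<omega> - 1\<bar> \<partial>M k) / \<epsilon>"
      using R V \<epsilon> by (intro add_mono prob_gt_le_expectation_abs) auto
    finally show ?thesis .
  qed
  have "(\<lambda>k. (\<integral>\<omega>. \<bar>R k \<omega>\<bar> \<partial>M k) / \<epsilon> + (\<integral>\<omega>. \<bar>V k \<omega> - 1\<bar> \<partial>M k) / \<epsilon>) \<longlonglongrightarrow> 0 / \<epsilon> + 0 / \<epsilon>"
    using \<epsilon> by (intro tendsto_intros R0 V1) auto
  then have "(\<lambda>k. (\<integral>\<omega>. \<bar>R k \<omega>\<bar> \<partial>M k) / \<epsilon> + (\<integral>\<omega>. \<bar>V k \<omega> - 1\<bar> \<partial>M k) / \<epsilon>) \<longlonglongrightarrow> 0" by simp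
  then show "(\<lambda>k. measure (M k) (?B k)) \<longlonglongrightarrow> 0"
    by (rule Lim_null_comparison[rotated]) (use le in \<open>auto intro!: always_eventually\<close>)
qed

section \<open>Deterministic bounds on the coefficients and estimators\<close>

lemma abs_mult_le: "\<bar>x\<bar> \<le> a \<Longrightarrow> \<bar>y\<bar> \<le> b \<Longrightarrow> \<bar>x * y\<bar> \<le> a * b" for x y a b :: real
  unfolding abs_mult by (intro mult_mono) auto

text \<open>Cancelling the powers of \<open>m\<close> turns the estimator into a product of factors
  \<open>r j\<close>, each within \<open>O(1 / m)\<close> of \<open>q\<close>; the factors are
  replaced by \<open>q\<close> one at a time.\<close>

lemma eta_hat_approx:
  fixes m :: nat and q :: real
  assumes m: "m \<ge> 4" and q: "0 \<le> q" "q \<le> 1"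
  shows "eta_hat m q 1 = q" "\<bar>eta_hat m q 2 - q ^ 2\<bar> \<le> 2 / m"
    "\<bar>eta_hat m q 3 - q ^ 3\<bar> \<le> 6 / m" "\<bar>eta_hat m q 4 - q ^ 4\<bar> \<le> 30 / m"
proof -
  define r where "r j = (real m * q - real j) / (real m - real j)" for j
  have eta: "eta_hat m q l = (\<Prod>j<l. r j)" for l
  proof -
    have "(\<Prod>j<l. q - real j / real m) = (\<Prod>j<l. (real m * q - real j) / real m)"
      using m by (intro prod.cong) (auto simp: field_simps)
    also have "\<dots> = (\<Prod>j<l. real m * q - real j) / real m ^ l"
      by (simp add: prod_dividef)
    finally show ?thesis using m by (simp add: eta_hat_def r_def prod_dividef)
  qed
  have r0: "r 0 = q" using m by (simp add: r_def)
  have d: "\<bar>r j - q\<bar> \<le> real j / (real m - real j)" if "j < 4" for j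
  proof -
    have pos: "real m - real j > 0" using that m by simp
    have "r j - q = - (real j * (1 - q) / (real m - real j))"
      using pos by (simp add: r_def field_simps)
    moreover have "real j * (1 - q) \<le> real j * 1" using q by (intro mult_left_mono) auto
    moreover have "0 \<le> real j * (1 - q)" using q by simp
    ultimately show ?thesis using pos by (simp add: divide_right_mono)
  qed
  \<comment> \<open>The quotient \<open>j * m / (m - j)\<close> is largest at \<open>m = 4\<close>,
    where it is 4/3, 4 and 12 for \<open>j = 1, 2, 3\<close>; the first value is rounded up to
    2.\<close>
  have d1: "\<bar>r 1 - q\<bar> \<le> 2 / m" and d2: "\<bar>r 2 - q\<bar> \<le> 4 / m" and d3: "\<bar>r 3 - q\<bar> \<le> 12 / m"
    by (rule order_trans[OF d]; use m in \<open>simp add: divide_simps\<close>)+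
  have mq: "0 \<le> real m * q" "real m * q \<le> real m" "4 \<le> real m"
    using m q mult_left_mono[OF q(2), of "real m"] by auto
  have b2: "\<bar>r 2\<bar> \<le> 1"
  proof -
    have "\<bar>real m * q - 2\<bar> \<le> real m - 2"
      using mq unfolding abs_le_iff by argo
    then show ?thesis using m by (simp add: r_def)
  qed
  \<comment> \<open>The last factor reaches -3 at \<open>m = 4\<close> and \<open>q = 0\<close>, so
    it may triple the previous error: 6 * 3 + 12 = 30.\<close>
  have b3: "\<bar>r 3\<bar> \<le> 3"
  proof -
    have "\<bar>real m * q - 3\<bar> \<le> 3 * (real m - 3)"
      using mq unfolding abs_le_iff by argo
    then show ?thesis using m by (simp add: r_def divide_simps)
  qed
  have q1: "\<bar>q\<bar> \<le> 1" "\<bar>q ^ 2\<bar> \<le> 1" "\<bar>q ^ 3\<bar> \<le> 1" using q by (auto simp: power_le_one)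
  show "eta_hat m q 1 = q" by (simp add: eta r0)
  have e2: "eta_hat m q 2 = q * r 1" by (simp add: eta r0 numeral_eq_Suc)
  have e3: "eta_hat m q 3 = eta_hat m q 2 * r 2" unfolding eta by (simp add: numeral_eq_Suc)
  have e4: "eta_hat m q 4 = eta_hat m q 3 * r 3" unfolding eta by (simp add: numeral_eq_Suc)
  have "eta_hat m q 2 - q ^ 2 = q * (r 1 - q)" by (simp add: e2 power2_eq_square algebra_simps)
  then show a2: "\<bar>eta_hat m q 2 - q ^ 2\<bar> \<le> 2 / m" using abs_mult_le[OF q1(1) d1] by simp
  have "eta_hat m q 3 - q ^ 3 = (eta_hat m q 2 - q ^ 2) * r 2 + q ^ 2 * (r 2 - q)"
    by (simp add: e3 power2_eq_square power3_eq_cube algebra_simps)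
  then show a3: "\<bar>eta_hat m q 3 - q ^ 3\<bar> \<le> 6 / m"
    using abs_mult_le[OF a2 b2] abs_mult_le[OF q1(2) d2] by simp
  have q4: "q ^ 4 = q ^ 3 * q" by (simp add: eval_nat_numeral)
  have "eta_hat m q 4 - q ^ 4 = (eta_hat m q 3 - q ^ 3) * r 3 + q ^ 3 * (r 3 - q)"
    unfolding e4 by (simp add: q4 algebra_simps)
  then show "\<bar>eta_hat m q 4 - q ^ 4\<bar> \<le> 30 / m"
    using abs_mult_le[OF a3 b3] abs_mult_le[OF q1(3) d3] by simp
qed

section \<open>Coefficients of the variance estimators\<close>

lemma size_le_total_size: "i \<in> {1..k} \<Longrightarrow> n i \<le> total_size k n"
  unfolding total_size_def by (rule member_le_sum) auto

lemma d_coeff_bounds: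
  assumes i: "i \<in> {1..k}" and n: "n i \<ge> 4"
  shows "0 \<le> d_coeff k n i" "d_coeff k n i \<le> 4 / 3"
proof -
  define u where "u = real (n i) / (real (n i) - 1)"
  define w where "w = 1 - real (n i) / real (total_size k n)"
  have d: "d_coeff k n i = u * w" by (simp add: d_coeff_def u_def w_def)
  have u: "0 \<le> u" "u \<le> 4 / 3" using n by (auto simp: u_def divide_simps)
  have w: "0 \<le> w" "w \<le> 1" using size_le_total_size[OF i, of n] n by (auto simp: w_def divide_simps)
  show "0 \<le> d_coeff k n i" using u w by (simp add: d)
  show "d_coeff k n i \<le> 4 / 3" using mult_mono[OF u(2) w(2)] u w by (simp add: d)
qed

text \<open>Everything except the constant 2 carries a factor \<open>h = 1 / n i\<close>, and the
  cofactor is a polynomial in the bounded quantities \<open>d\<close> and \<open>h\<close>. The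
  constant 30 is generous; only the order matters.\<close>

lemma A1_coeff_approx:
  assumes i: "i \<in> {1..k}" and n: "n i \<ge> 4"
  shows "\<bar>A1_coeff k n i - 2\<bar> \<le> 30 / n i"
proof -
  define d where "d = d_coeff k n i"
  define h where "h = 1 / real (n i)"
  have d: "0 \<le> d" "d \<le> 4 / 3" using d_coeff_bounds[where n=n, OF i n] by (auto simp: d_def)
  have h: "0 \<le> h" "h \<le> 1 / 4" using n by (auto simp: h_def field_simps)
  have d2: "0 \<le> d ^ 2" "d ^ 2 \<le> 16 / 9" using power_mono[OF d(2,1), of 2] by (auto simp: power_divide)
  define c where "c = - 6 - d ^ 2 + 8 * d ^ 2 * h - 6 * d ^ 2 * h ^ 2 + 12 * d * (1 - h)"
  have "A1_coeff k n i - 2 = h * c"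
    using n by (simp add: A1_coeff_def Let_def d_def[symmetric] c_def h_def field_simps power2_eq_square power3_eq_cube)
  moreover have "\<bar>c\<bar> \<le> 30"
  proof -
    have "0 \<le> d ^ 2 * h" "d ^ 2 * h \<le> 4 / 9" "0 \<le> d ^ 2 * h ^ 2" "d ^ 2 * h ^ 2 \<le> 1 / 9"
      using d2 h mult_mono[OF d2(2) h(2)] mult_mono[OF d2(2) power_mono[OF h(2,1), of 2]]
      by (auto simp: power_divide)
    moreover have "0 \<le> d * (1 - h)" "d * (1 - h) \<le> (4 / 3) * 1" using d h by (intro mult_nonneg_nonneg mult_mono; simp)+
    ultimately show ?thesis
      using d2 unfolding c_def abs_le_iff mult.assoc by argo
  qed
  ultimately show ?thesis using h mult_left_mono[of "\<bar>c\<bar>" 30 h] by (simp add: abs_mult h_def)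
qed

text \<open>The sum regroups as
  \<open>A2 * (eta_1 - eta_2) + A1 * (eta_2 - 2 * eta_3 + eta_4)\<close>. The first coefficient is
  small, \<open>A1\<close> is close to 2, and the last bracket is close to
  \<open>(q * (1 - q)) ^ 2\<close>. Allowing any \<open>m \<ge> n i\<close> covers both the group
  size and the pooled size.\<close>

lemma variance_summand_approx:
  assumes i: "i \<in> {1..k}" and n: "n i \<ge> 4" and m: "n i \<le> m" and q: "0 \<le> q" "q \<le> 1"
  shows "\<bar>(\<Sum>l=1..4. a_coeff k n l i * eta_hat m q l) - 2 * (q * (1 - q)) ^ 2\<bar> \<le> 500 / n i"
proof -
  define A1 where "A1 = A1_coeff k n i"
  define A2 where "A2 = A2_coeff k n i"
  define h where "h = 1 / real (n i)"
  have h: "0 \<le> h" "h \<le> 1 / 4" using n by (auto simp: h_def field_simps)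
  have hm: "1 / real m \<le> h" using n m by (simp add: h_def field_simps)
  have m4: "m \<ge> 4" using n m by simp
  note e = eta_hat_approx[OF m4 q]
  define \<epsilon> where "\<epsilon> = eta_hat m q 2 - 2 * eta_hat m q 3 + eta_hat m q 4 - (q * (1 - q)) ^ 2"
  have "\<epsilon> = (eta_hat m q 2 - q ^ 2) - 2 * (eta_hat m q 3 - q ^ 3) + (eta_hat m q 4 - q ^ 4)"
    by (simp add: \<epsilon>_def eval_nat_numeral algebra_simps)
  moreover have "2 / real m \<le> 2 * h" "6 / real m \<le> 6 * h" "30 / real m \<le> 30 * h" using hm by simp_all
  \<comment> \<open>The weights 1, -2, 1 give 2 + 2 * 6 + 30 = 44.\<close>
  ultimately have eps: "\<bar>\<epsilon>\<bar> \<le> 44 * h"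
    using e(2-4) unfolding abs_le_iff by argo
  have A1: "\<bar>A1 - 2\<bar> \<le> 30 * h" using A1_coeff_approx[where n=n, OF i n] by (simp add: A1_def h_def)
  then have A1': "\<bar>A1\<bar> \<le> 10" using h by linarith
  have A2: "\<bar>A2\<bar> \<le> h"
  proof -
    have "real (n i) * real (n i) \<le> real (total_size k n) ^ 2"
      unfolding power2_eq_square using size_le_total_size[OF i, of n] by (intro mult_mono) auto
    moreover have "real (total_size k n) > 0" using size_le_total_size[OF i, of n] n by simp
    ultimately show ?thesis using n by (simp add: A2_def A2_coeff_def h_def divide_simps)
  qed
  have qq: "0 \<le> q * (1 - q)" "q * (1 - q) \<le> 1 / 4" using q mult_one_minus_le_quarter[of q] by simp_all
  have q4: "\<bar>(q * (1 - q)) ^ 2\<bar> \<le> 1" using qq by (auto simp: abs_square_le_1)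
  have e12: "\<bar>q - eta_hat m q 2\<bar> \<le> 2"
  proof -
    have "q - eta_hat m q 2 = q * (1 - q) - (eta_hat m q 2 - q ^ 2)"
      by (simp add: power2_eq_square algebra_simps)
    moreover have "2 / real m \<le> 1 / 2" using hm h by simp
    ultimately show ?thesis using e(2) qq by linarith
  qed
  have "{1..4} = {1, 2, 3, 4 :: nat}" by auto
  then have "(\<Sum>l=1..4. a_coeff k n l i * eta_hat m q l) - 2 * (q * (1 - q)) ^ 2
      = A2 * (q - eta_hat m q 2) + (A1 - 2) * (q * (1 - q)) ^ 2 + A1 * \<epsilon>"
    using e(1) by (simp add: a_coeff_def A1_def A2_def \<epsilon>_def algebra_simps)
  also have "\<bar>\<dots>\<bar> \<le> h * 2 + 30 * h * 1 + 10 * (44 * h)"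
    using abs_mult_le[OF A2 e12] abs_mult_le[OF A1 q4] abs_mult_le[OF A1' eps] by linarith
  \<comment> \<open>The sum 2 + 30 + 440 = 472 is rounded up.\<close>
  also have "\<dots> \<le> 500 / n i" by (simp add: h_def divide_right_mono)
  finally show ?thesis .
qed

text \<open>Both differences factor through \<open>q - p\<close>: the cofactor
  \<open>1 - q - p\<close> lies in [-1, 1], and the sum of the two products is at most 1/2, which
  offsets the factor 2.\<close>

lemma square_mult_one_minus_lipschitz:
  fixes p q :: real
  assumes "0 \<le> p" "p \<le> 1" "0 \<le> q" "q \<le> 1"
  shows "\<bar>q * (1 - q) - p * (1 - p)\<bar> \<le> \<bar>q - p\<bar>"
    and "\<bar>2 * (q * (1 - q)) ^ 2 - 2 * (p * (1 - p)) ^ 2\<bar> \<le> \<bar>q - p\<bar>"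
proof -
  have "q * (1 - q) - p * (1 - p) = (q - p) * (1 - q - p)" by (simp add: algebra_simps)
  then show 1: "\<bar>q * (1 - q) - p * (1 - p)\<bar> \<le> \<bar>q - p\<bar>"
    using abs_mult_le[of "q - p" "\<bar>q - p\<bar>" "1 - q - p" 1] assms by simp
  have 2: "\<bar>q * (1 - q) + p * (1 - p)\<bar> \<le> 1 / 2"
    using assms mult_one_minus_le_quarter[of q] mult_one_minus_le_quarter[of p] by (simp add: abs_le_iff)
  have "2 * (q * (1 - q)) ^ 2 - 2 * (p * (1 - p)) ^ 2
      = 2 * ((q * (1 - q) - p * (1 - p)) * (q * (1 - q) + p * (1 - p)))"
    by (simp add: power2_eq_square algebra_simps)
  then show "\<bar>2 * (q * (1 - q)) ^ 2 - 2 * (p * (1 - p)) ^ 2\<bar> \<le> \<bar>q - p\<bar>"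
    using abs_mult_le[OF 1 2] by simp
qed

section \<open>One row of the array\<close>

text \<open>Independence and centring remove the cross terms. Integrability and value form one
  conjunction so that the induction carries both.\<close>

lemma (in prob_space) indep_vars_sum_square:
  fixes U :: "'i \<Rightarrow> 'a \<Rightarrow> real"
  assumes "finite I" "indep_vars (\<lambda>_. borel) U I"
    and "\<And>i. i \<in> I \<Longrightarrow> integrable M (\<lambda>\<omega>. U i \<omega> ^ 2)" "\<And>i. i \<in> I \<Longrightarrow> expectation (U i) = 0"
  shows "integrable M (\<lambda>\<omega>. (\<Sum>i\<in>I. U i \<omega>) ^ 2) \<and>
    expectation (\<lambda>\<omega>. (\<Sum>i\<in>I. U i \<omega>) ^ 2) = (\<Sum>i\<in>I. expectation (\<lambda>\<omega>. U i \<omega> ^ 2))"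
  using assms
proof (induction I rule: finite_induct)
  case (insert i I)
  have rv: "random_variable borel (U j)" if "j \<in> insert i I" for j
    using insert.prems(1) that by (auto simp: indep_vars_def)
  have int: "integrable M (U j)" if "j \<in> insert i I" for j
    using square_integrable_imp_integrable[OF rv insert.prems(2)] that by auto
  have IH: "integrable M (\<lambda>\<omega>. (\<Sum>i\<in>I. U i \<omega>) ^ 2)"
    "expectation (\<lambda>\<omega>. (\<Sum>i\<in>I. U i \<omega>) ^ 2) = (\<Sum>i\<in>I. expectation (\<lambda>\<omega>. U i \<omega> ^ 2))"
    using insert.IH[OF indep_vars_subset[OF insert.prems(1)]] insert.prems by auto
  note ind = indep_vars_sum[OF insert.hyps insert.prems(1)]
  have sum_int: "integrable M (\<lambda>\<omega>. \<Sum>i\<in>I. U i \<omega>)" using int by auto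
  note cross = indep_var_integrable[OF ind int sum_int] indep_var_lebesgue_integral[OF ind int sum_int]
  have "(\<Sum>i\<in>insert i I. U i \<omega>) ^ 2 = U i \<omega> ^ 2 + (\<Sum>i\<in>I. U i \<omega>) ^ 2 + 2 * (U i \<omega> * (\<Sum>i\<in>I. U i \<omega>))" for \<omega>
    using insert.hyps by (simp add: power2_sum)
  then show ?case
    using insert.hyps insert.prems(2,3) IH cross by simp
qed simp

text \<open>This is the nonnegativity of the variance of \<open>\<bar>U\<bar>\<close>.\<close>

lemma (in prob_space) expectation_abs_le_sqrt:
  fixes U :: "'a \<Rightarrow> real"
  assumes "random_variable borel U" "integrable M (\<lambda>\<omega>. U \<omega> ^ 2)"
  shows "expectation (\<lambda>\<omega>. \<bar>U \<omega>\<bar>) \<le> sqrt (expectation (\<lambda>\<omega>. U \<omega> ^ 2))"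
proof (rule real_le_rsqrt)
  have int: "integrable M U" by (rule square_integrable_imp_integrable[OF assms])
  have "0 \<le> variance (\<lambda>\<omega>. \<bar>U \<omega>\<bar>)" by (rule variance_positive)
  also have "\<dots> = expectation (\<lambda>\<omega>. U \<omega> ^ 2) - (expectation (\<lambda>\<omega>. \<bar>U \<omega>\<bar>)) ^ 2"
    using int assms by (subst variance_eq) auto
  finally show "(expectation (\<lambda>\<omega>. \<bar>U \<omega>\<bar>)) ^ 2 \<le> expectation (\<lambda>\<omega>. U \<omega> ^ 2)" by simp
qed

locale binomial_samples = prob_space M for M :: "'a measure" +
  fixes X :: "nat \<Rightarrow> 'a \<Rightarrow> nat" and n :: "nat \<Rightarrow> nat" and k :: nat and p \<theta> :: real
  assumes k: "k \<ge> 1"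
    and indep: "indep_vars (\<lambda>_. count_space UNIV) X {1..k}"
    and binomial: "\<And>i. i \<in> {1..k} \<Longrightarrow>
      distr M (count_space UNIV) (X i) = measure_pmf (binomial_pmf (n i) p)"
    and size: "\<And>i. i \<in> {1..k} \<Longrightarrow> n i \<ge> 4"
    and p: "0 < p" "p < 1"
    and \<theta>: "\<theta> = p * (1 - p)"
begin

definition N :: real where "N = real (total_size k n)"
definition inv_sizes :: real where "inv_sizes = (\<Sum>i=1..k. 1 / real (n i))"
definition q :: "nat \<Rightarrow> 'a \<Rightarrow> real" where "q i \<omega> = pi_hat n (\<lambda>i. X i \<omega>) i"
definition pooled :: "'a \<Rightarrow> real" where "pooled \<omega> = pi_hat_pooled k n (\<lambda>i. X i \<omega>)"
definition Y :: "nat \<Rightarrow> 'a \<Rightarrow> real" where "Y i \<omega> = real (X i \<omega>) - real (n i) * p"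
definition Z :: "nat \<Rightarrow> 'a \<Rightarrow> real" where "Z i \<omega> = Y i \<omega> ^ 2 / real (n i) - \<theta>"
text \<open>The subtracted constant is the exact mean of
  \<open>q i \<omega> * (1 - q i \<omega>)\<close>, bias factor included.\<close>

definition g :: "nat \<Rightarrow> 'a \<Rightarrow> real" where
  "g i \<omega> = q i \<omega> * (1 - q i \<omega>) - \<theta> * (1 - 1 / real (n i))"
definition R :: "'a \<Rightarrow> real" where
  "R \<omega> = - (\<Sum>i=1..k. d_coeff k n i * g i \<omega>) - ((\<Sum>i=1..k. Y i \<omega>) ^ 2 / N - \<theta>)"
text \<open>The square of \<open>s\<close> is the leading part of the variance of the sum of the
  \<open>Z i\<close>.\<close>

definition s :: real where "s = \<theta> * sqrt (2 * real k)"

lemma p01: "p \<in> {0..1}" using p by simp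

lemma theta_bounds: "0 < \<theta>" "\<theta> \<le> 1 / 4"
  using p mult_one_minus_le_quarter[of p] by (simp_all add: \<theta>)

lemma n_ge: "i \<in> {1..k} \<Longrightarrow> real (n i) \<ge> 4"
  using size[of i] by simp

lemma N_ge: "i \<in> {1..k} \<Longrightarrow> real (n i) \<le> N"
  using size_le_total_size[of i k n] by (simp add: N_def)

lemma N_pos: "N > 0"
  using N_ge[of 1] n_ge[of 1] k by simp

lemma N_sum: "N = (\<Sum>i=1..k. real (n i))"
  by (simp add: N_def total_size_def)

lemma rv_X: "i \<in> {1..k} \<Longrightarrow> X i \<in> M \<rightarrow>\<^sub>M count_space UNIV"
  using indep by (auto simp: indep_vars_def)

lemma rv_comp: "i \<in> {1..k} \<Longrightarrow> (\<lambda>\<omega>. f (X i \<omega>) :: real) \<in> borel_measurable M"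
  using measurable_compose[OF rv_X, of i f borel] by simp

lemma indep_comp: "indep_vars (\<lambda>_. borel) (\<lambda>i \<omega>. f i (X i \<omega>) :: real) {1..k}"
  by (rule indep_vars_compose2[OF indep]) simp

text \<open>The binomial law has finite support, so every function of a single \<open>X i\<close> is
  integrable.\<close>

lemma integrable_comp: "i \<in> {1..k} \<Longrightarrow> integrable M (\<lambda>\<omega>. f (X i \<omega>) :: real)"
  using integrable_distr_eq[OF rv_X, of i f] integrable_binomial_pmf[OF p01, of "n i" f]
  by (simp add: binomial)

lemma expectation_comp:
  "i \<in> {1..k} \<Longrightarrow> expectation (\<lambda>\<omega>. f (X i \<omega>) :: real) = measure_pmf.expectation (binomial_pmf (n i) p) f"
  using integral_distr[OF rv_X, of i f] binomial[of i] by simp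

text \<open>Each \<open>X i\<close> is prescribed only in law, so the bound by \<open>n i\<close>,
  and with it the proportions lying in the unit interval, is available almost surely.\<close>

lemma AE_X: "AE \<omega> in M. \<forall>i\<in>{1..k}. X i \<omega> \<le> n i"
proof (rule AE_finite_allI)
  fix i assume i: "i \<in> {1..k}"
  have "AE x in measure_pmf (binomial_pmf (n i) p). x \<le> n i"
    using p by (simp add: AE_measure_pmf_iff)
  then have "AE x in distr M (count_space UNIV) (X i). x \<le> n i"
    unfolding binomial[OF i] .
  then show "AE \<omega> in M. X i \<omega> \<le> n i"
    using rv_X[OF i] by (simp add: AE_distr_iff)
qed simp

lemma q_bounds: "X i \<omega> \<le> n i \<Longrightarrow> 0 \<le> q i \<omega> \<and> q i \<omega> \<le> 1"
  by (auto simp: q_def pi_hat_def divide_simps)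

lemma q_eq: "i \<in> {1..k} \<Longrightarrow> q i \<omega> = p + Y i \<omega> / real (n i)"
  using n_ge[of i] by (simp add: q_def pi_hat_def Y_def field_simps)

lemma pooled_eq: "pooled \<omega> = p + (\<Sum>i=1..k. Y i \<omega>) / N"
proof -
  have "(\<Sum>i=1..k. real (n i) * pi_hat n (\<lambda>i. X i \<omega>) i) = (\<Sum>i=1..k. Y i \<omega> + real (n i) * p)"
    using n_ge by (intro sum.cong) (force simp: pi_hat_def Y_def)+
  also have "\<dots> = (\<Sum>i=1..k. Y i \<omega>) + N * p"
    by (simp add: sum.distrib N_sum sum_distrib_right)
  finally show ?thesis using N_pos
    by (simp add: pooled_def pi_hat_pooled_def N_def[symmetric] field_simps)
qed

lemma pooled_bounds:
  assumes "\<forall>i\<in>{1..k}. X i \<omega> \<le> n i"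
  shows "0 \<le> pooled \<omega>" "pooled \<omega> \<le> 1"
proof -
  have "(\<Sum>i=1..k. real (n i) * pi_hat n (\<lambda>i. X i \<omega>) i) = (\<Sum>i=1..k. real (X i \<omega>))"
    using n_ge by (intro sum.cong) (force simp: pi_hat_def)+
  then have eq: "pooled \<omega> = (\<Sum>i=1..k. real (X i \<omega>)) / N"
    by (simp add: pooled_def pi_hat_pooled_def N_def)
  have "(\<Sum>i=1..k. real (X i \<omega>)) \<le> N" unfolding N_sum using assms by (intro sum_mono) auto
  then show "0 \<le> pooled \<omega>" "pooled \<omega> \<le> 1" using N_pos by (auto simp: eq sum_nonneg)
qed

text \<open>Centring the \<open>d\<^sub>i\<close>-terms exactly matters: their means add up to a term that need not be
  negligible against \<open>s\<close>.\<close>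

lemma T_decomposition: "T_stat k n (\<lambda>i. X i \<omega>) = (\<Sum>i=1..k. Z i \<omega>) + R \<omega>"
proof -
  define H where "H = (\<Sum>i=1..k. Y i \<omega>)"
  define c where "c = H / N"
  have "(\<Sum>i=1..k. real (n i) * (q i \<omega> - pooled \<omega>) ^ 2)
      = (\<Sum>i=1..k. Y i \<omega> ^ 2 / real (n i) - 2 * c * Y i \<omega> + c ^ 2 * real (n i))"
  proof (intro sum.cong refl)
    fix i assume i: "i \<in> {1..k}"
    have "real (n i) * (q i \<omega> - pooled \<omega>) ^ 2 = real (n i) * (Y i \<omega> / real (n i) - c) ^ 2"
      unfolding q_eq[OF i] pooled_eq H_def c_def by simp
    also have "\<dots> = Y i \<omega> ^ 2 / real (n i) - 2 * c * Y i \<omega> + c ^ 2 * real (n i)"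
      using n_ge[OF i] by (simp add: power2_diff power_divide algebra_simps) (simp add: power2_eq_square)
    finally show "real (n i) * (q i \<omega> - pooled \<omega>) ^ 2
      = Y i \<omega> ^ 2 / real (n i) - 2 * c * Y i \<omega> + c ^ 2 * real (n i)" .
  qed
  also have "\<dots> = (\<Sum>i=1..k. Y i \<omega> ^ 2 / real (n i)) - 2 * c * H + c ^ 2 * N"
    by (simp add: sum.distrib sum_subtractf H_def N_sum flip: sum_distrib_left)
  also have "\<dots> = (\<Sum>i=1..k. Y i \<omega> ^ 2 / real (n i)) - H ^ 2 / N"
    using N_pos by (simp add: c_def power2_eq_square field_simps)
  finally have 1: "(\<Sum>i=1..k. real (n i) * (q i \<omega> - pooled \<omega>) ^ 2)
      = (\<Sum>i=1..k. Y i \<omega> ^ 2 / real (n i)) - H ^ 2 / N" .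
  have "(\<Sum>i=1..k. d_coeff k n i * q i \<omega> * (1 - q i \<omega>))
      = (\<Sum>i=1..k. d_coeff k n i * g i \<omega> + \<theta> * (1 - real (n i) / N))"
  proof (intro sum.cong refl)
    fix i assume i: "i \<in> {1..k}"
    \<comment> \<open>The factor \<open>n i / (n i - 1)\<close> in \<open>d_coeff\<close> cancels
      the bias factor \<open>1 - 1 / n i\<close>, so the means of the \<open>d\<close>-terms add up
      to \<open>\<theta> * (k - 1)\<close>.\<close>
    have "d_coeff k n i * (1 - 1 / real (n i)) = 1 - real (n i) / N"
      using n_ge[OF i] N_pos by (simp add: d_coeff_def N_def[symmetric] divide_simps)
    then have "d_coeff k n i * (\<theta> * (1 - 1 / real (n i))) = \<theta> * (1 - real (n i) / N)"
      by (metis mult.left_commute)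
    then show "d_coeff k n i * q i \<omega> * (1 - q i \<omega>) = d_coeff k n i * g i \<omega> + \<theta> * (1 - real (n i) / N)"
      by (simp add: g_def algebra_simps)
  qed
  also have "\<dots> = (\<Sum>i=1..k. d_coeff k n i * g i \<omega>) + \<theta> * (real k - N / N)"
    by (simp add: sum.distrib sum_subtractf N_sum flip: sum_distrib_left sum_divide_distrib)
  finally have 2: "(\<Sum>i=1..k. d_coeff k n i * q i \<omega> * (1 - q i \<omega>))
      = (\<Sum>i=1..k. d_coeff k n i * g i \<omega>) + \<theta> * (real k - 1)" using N_pos by simp
  show ?thesis
    unfolding T_stat_def q_def[symmetric] pooled_def[symmetric] 1 2 R_def Z_def H_def
    by (simp add: sum_subtractf algebra_simps)
qed

section \<open>Moments of the main summands and of the remainder\<close>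

lemma moment_Y: "i \<in> {1..k} \<Longrightarrow> expectation (\<lambda>\<omega>. Y i \<omega> ^ j) = binomial_cmoment j (n i) p"
  unfolding Y_def binomial_cmoment_def by (rule expectation_comp)

lemma integrable_Y: "i \<in> {1..k} \<Longrightarrow> integrable M (\<lambda>\<omega>. Y i \<omega> ^ j)"
  unfolding Y_def by (rule integrable_comp)

lemma expectation_Y: "i \<in> {1..k} \<Longrightarrow> expectation (Y i) = 0"
  using moment_Y[of i 1] binomial_cmoment_1[OF p01] by simp

lemma variance_Y: "i \<in> {1..k} \<Longrightarrow> expectation (\<lambda>\<omega>. Y i \<omega> ^ 2) = real (n i) * \<theta>"
  by (simp add: moment_Y binomial_cmoment_2[OF p01 \<theta>])

lemma expectation_Z: "i \<in> {1..k} \<Longrightarrow> expectation (Z i) = 0"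
  using n_ge[of i] by (simp add: Z_def[abs_def] integrable_Y variance_Y prob_space)

lemma variance_Z:
  assumes i: "i \<in> {1..k}"
  shows "expectation (\<lambda>\<omega>. Z i \<omega> ^ 2) = 2 * \<theta> ^ 2 + \<theta> * (1 - 6 * \<theta>) / real (n i)"
proof -
  have "Z i \<omega> ^ 2 = Y i \<omega> ^ 4 / real (n i) ^ 2 - 2 * \<theta> / real (n i) * Y i \<omega> ^ 2 + \<theta> ^ 2" for \<omega>
    by (simp add: Z_def power2_diff power_divide flip: power_mult)
  then have "expectation (\<lambda>\<omega>. Z i \<omega> ^ 2)
    = (3 * (n i * \<theta>) ^ 2 + n i * \<theta> * (1 - 6 * \<theta>)) / real (n i) ^ 2 - 2 * \<theta> / real (n i) * (n i * \<theta>) + \<theta> ^ 2"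
    using i by (simp add: integrable_Y variance_Y prob_space moment_Y binomial_cmoment_4[OF p01 \<theta>])
  also have "\<dots> = 2 * \<theta> ^ 2 + \<theta> * (1 - 6 * \<theta>) / real (n i)"
    using n_ge[OF i] by (simp add: field_simps power2_eq_square)
  finally show ?thesis .
qed

lemma integrable_Z3: "i \<in> {1..k} \<Longrightarrow> integrable M (\<lambda>\<omega>. \<bar>Z i \<omega>\<bar> ^ 3)"
  unfolding Z_def Y_def by (rule integrable_comp)

text \<open>The inequality \<open>\<bar>u - v\<bar> ^ 3 \<le> 4 * (u ^ 3 + v ^ 3)\<close> leads to
  the sixth central moment. Its cubic term and the centring give 4 * 15 + 4 = 64; the lower order
  terms, 4 * 25 and 4, are both dominated by \<open>\<theta> / n i\<close> and merge into
  104.\<close>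

lemma third_moment_Z:
  assumes i: "i \<in> {1..k}"
  shows "expectation (\<lambda>\<omega>. \<bar>Z i \<omega>\<bar> ^ 3) \<le> 64 * \<theta> ^ 3 + 104 * \<theta> / real (n i)"
proof -
  have n: "real (n i) > 0" using n_ge[OF i] by simp
  have cube: "\<bar>u - v\<bar> ^ 3 \<le> 4 * (u ^ 3 + v ^ 3)" if "0 \<le> u" "0 \<le> v" for u v :: real
  proof -
    have "\<bar>u - v\<bar> ^ 3 \<le> (u + v) ^ 3" using that by (intro power_mono) auto
    moreover have "4 * (u ^ 3 + v ^ 3) - (u + v) ^ 3 = 3 * ((u + v) * (u - v) ^ 2)"
      by (simp add: power2_eq_square power3_eq_cube algebra_simps)
    moreover have "0 \<le> (u + v) * (u - v) ^ 2" using that by simp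
    ultimately show ?thesis by argo
  qed
  have pw: "\<bar>Z i \<omega>\<bar> ^ 3 \<le> 4 * (Y i \<omega> ^ 6 / real (n i) ^ 3 + \<theta> ^ 3)" for \<omega>
    using cube[of "Y i \<omega> ^ 2 / real (n i)" \<theta>] theta_bounds
    by (simp add: Z_def power_divide flip: power_mult)
  have "expectation (\<lambda>\<omega>. \<bar>Z i \<omega>\<bar> ^ 3) \<le> expectation (\<lambda>\<omega>. 4 * (Y i \<omega> ^ 6 / real (n i) ^ 3 + \<theta> ^ 3))"
    using integrable_Z3[OF i] integrable_Y[OF i] pw by (intro integral_mono) auto
  also have "\<dots> = 4 * (binomial_cmoment 6 (n i) p / real (n i) ^ 3 + \<theta> ^ 3)"
    using i by (simp add: integrable_Y moment_Y prob_space)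
  also have "\<dots> \<le> 4 * ((15 * (n i * \<theta>) ^ 3 + 25 * (n i * \<theta>) ^ 2 + n i * \<theta>) / real (n i) ^ 3 + \<theta> ^ 3)"
    using n by (intro mult_left_mono add_right_mono divide_right_mono binomial_cmoment_6_le[OF p01 \<theta>]) auto
  also have "\<dots> = 64 * \<theta> ^ 3 + 100 * (\<theta> * \<theta> / real (n i)) + 4 * (\<theta> / (real (n i) * real (n i)))"
    using n by (simp add: field_simps power2_eq_square power3_eq_cube)
  also have "\<dots> \<le> 64 * \<theta> ^ 3 + 100 * (\<theta> / real (n i)) + 4 * (\<theta> / real (n i))"
  proof (intro add_mono mult_left_mono order_refl)
    show "\<theta> * \<theta> / real (n i) \<le> \<theta> / real (n i)" using theta_bounds n by (simp add: divide_right_mono)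
    show "\<theta> / (real (n i) * real (n i)) \<le> \<theta> / real (n i)"
      using theta_bounds n n_ge[OF i] by (intro divide_left_mono) auto
  qed auto
  finally show ?thesis by simp
qed

text \<open>Substituting \<open>q = p + Y / n\<close> makes \<open>g i\<close> a quadratic
  polynomial in \<open>Y i\<close>, so the first two moments decide.\<close>

lemma expectation_g:
  assumes i: "i \<in> {1..k}"
  shows "expectation (g i) = 0"
proof -
  have "g i = (\<lambda>\<omega>. (1 - 2 * p) / real (n i) * Y i \<omega> - Y i \<omega> ^ 2 / real (n i) ^ 2 + \<theta> / real (n i))"
    unfolding g_def[abs_def] q_eq[OF i] fun_eq_iff
    using n_ge[OF i] by (simp add: \<theta> field_simps power2_eq_square)
  then have "expectation (g i) = (1 - 2 * p) / real (n i) * 0 - (n i * \<theta>) / real (n i) ^ 2 + \<theta> / real (n i)"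
    using i integrable_Y[of i 1] by (simp add: integrable_Y variance_Y expectation_Y prob_space)
  also have "\<dots> = 0" using n_ge[OF i] by (simp add: power2_eq_square)
  finally show ?thesis .
qed

lemma integrable_g: "i \<in> {1..k} \<Longrightarrow> integrable M (\<lambda>\<omega>. f (g i \<omega>))" for f :: "real \<Rightarrow> real"
  unfolding g_def q_def pi_hat_def by (rule integrable_comp)

lemma q_msd:
  assumes i: "i \<in> {1..k}"
  shows "integrable M (\<lambda>\<omega>. (q i \<omega> - p) ^ 2)" "expectation (\<lambda>\<omega>. (q i \<omega> - p) ^ 2) = \<theta> / real (n i)"
  using n_ge[OF i] variance_Y[OF i] integrable_Y[OF i]
  by (simp_all add: q_eq[OF i] power_divide) (simp add: power2_eq_square)

text \<open>Since \<open>g i\<close> is centred, subtracting a constant can only increase its mean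
  square. Subtracting \<open>c\<close> turns it into \<open>q * (1 - q) - \<theta>\<close>, which is
  at most \<open>\<bar>q - p\<bar>\<close> in absolute value.\<close>

lemma variance_g:
  assumes i: "i \<in> {1..k}"
  shows "expectation (\<lambda>\<omega>. g i \<omega> ^ 2) \<le> \<theta> / real (n i)"
proof -
  define c where "c = \<theta> / real (n i)"
  have int: "integrable M (g i)" "integrable M (\<lambda>\<omega>. g i \<omega> ^ 2)" "integrable M (\<lambda>\<omega>. (g i \<omega> - c) ^ 2)"
    using integrable_g[OF i, of "\<lambda>x. x"] integrable_g[OF i, of "\<lambda>x. x ^ 2"] integrable_g[OF i, of "\<lambda>x. (x - c) ^ 2"] by auto
  have "expectation (\<lambda>\<omega>. g i \<omega> ^ 2) \<le> expectation (\<lambda>\<omega>. g i \<omega> ^ 2) + c ^ 2" by simp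
  also have "\<dots> = expectation (\<lambda>\<omega>. (g i \<omega> - c) ^ 2)"
    using int expectation_g[OF i] by (simp add: power2_diff prob_space)
  also have "\<dots> \<le> expectation (\<lambda>\<omega>. (q i \<omega> - p) ^ 2)"
  proof (rule integral_mono_AE[OF int(3) q_msd(1)[OF i]])
    show "AE \<omega> in M. (g i \<omega> - c) ^ 2 \<le> (q i \<omega> - p) ^ 2"
      using AE_X
    proof eventually_elim
      case (elim \<omega>)
      have "g i \<omega> - c = q i \<omega> * (1 - q i \<omega>) - \<theta>"
        by (simp add: g_def c_def algebra_simps)
      then have "\<bar>g i \<omega> - c\<bar> \<le> \<bar>q i \<omega> - p\<bar>"
        using square_mult_one_minus_lipschitz(1)[of p "q i \<omega>", folded \<theta>] p q_bounds[of i \<omega>] elim i by auto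
      then show ?case by (simp add: abs_le_square_iff)
    qed
  qed
  also have "\<dots> = \<theta> / real (n i)" by (rule q_msd(2)[OF i])
  finally show ?thesis .
qed

lemma sum_Y_square:
  "integrable M (\<lambda>\<omega>. (\<Sum>i=1..k. Y i \<omega>) ^ 2)" "expectation (\<lambda>\<omega>. (\<Sum>i=1..k. Y i \<omega>) ^ 2) = N * \<theta>"
proof -
  have "indep_vars (\<lambda>_. borel) Y {1..k}" unfolding Y_def by (rule indep_comp)
  from indep_vars_sum_square[OF _ this integrable_Y expectation_Y]
  show "integrable M (\<lambda>\<omega>. (\<Sum>i=1..k. Y i \<omega>) ^ 2)" "expectation (\<lambda>\<omega>. (\<Sum>i=1..k. Y i \<omega>) ^ 2) = N * \<theta>"
    by (auto simp: variance_Y N_sum sum_distrib_right)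
qed

text \<open>The centred \<open>d\<close>-terms are summed in L2 by independence, with
  \<open>(4 / 3) ^ 2 \<le> 2\<close> bounding the squared coefficients. The quadratic part
  \<open>H\<close> is nonnegative with mean \<theta>, so \<open>H + \<theta>\<close> dominates its
  deviation and has mean \<open>2 * \<theta>\<close>.\<close>

lemma R_bound: "integrable M R" "expectation (\<lambda>\<omega>. \<bar>R \<omega>\<bar>) \<le> sqrt (2 * \<theta> * inv_sizes) + 2 * \<theta>"
proof -
  define G where "G \<omega> = (\<Sum>i=1..k. d_coeff k n i * g i \<omega>)" for \<omega>
  define H where "H \<omega> = (\<Sum>i=1..k. Y i \<omega>) ^ 2 / N" for \<omega>
  have H: "integrable M H" "expectation H = \<theta>" "H \<omega> \<ge> 0" for \<omega>
    using sum_Y_square N_pos by (auto simp: H_def[abs_def])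
  have ind: "indep_vars (\<lambda>_. borel) (\<lambda>i \<omega>. d_coeff k n i * g i \<omega>) {1..k}"
    unfolding g_def q_def pi_hat_def by (rule indep_comp)
  have int_dg: "integrable M (\<lambda>\<omega>. (d_coeff k n i * g i \<omega>) ^ 2)" if "i \<in> {1..k}" for i
    by (rule integrable_g[OF that, of "\<lambda>x. (d_coeff k n i * x) ^ 2"])
  have sq: "integrable M (\<lambda>\<omega>. G \<omega> ^ 2)"
    "expectation (\<lambda>\<omega>. G \<omega> ^ 2) = (\<Sum>i=1..k. expectation (\<lambda>\<omega>. (d_coeff k n i * g i \<omega>) ^ 2))"
    using indep_vars_sum_square[OF _ ind int_dg] by (auto simp: G_def expectation_g)
  have "expectation (\<lambda>\<omega>. G \<omega> ^ 2) \<le> (\<Sum>i=1..k. 2 * \<theta> * (1 / real (n i)))"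
    unfolding sq(2)
  proof (rule sum_mono)
    fix i assume i: "i \<in> {1..k}"
    have d: "(d_coeff k n i) ^ 2 \<le> 2"
    proof -
      have "(d_coeff k n i) ^ 2 \<le> (4 / 3) ^ 2"
        using d_coeff_bounds[where n=n, OF i size[OF i]] by (intro power_mono) auto
      then show ?thesis by (simp add: power_divide)
    qed
    have "expectation (\<lambda>\<omega>. (d_coeff k n i * g i \<omega>) ^ 2) = (d_coeff k n i) ^ 2 * expectation (\<lambda>\<omega>. g i \<omega> ^ 2)"
      using integrable_g[OF i] by (simp add: power_mult_distrib)
    also have "\<dots> \<le> 2 * (\<theta> / real (n i))"
      using d variance_g[OF i] by (intro mult_mono) auto
    finally show "expectation (\<lambda>\<omega>. (d_coeff k n i * g i \<omega>) ^ 2) \<le> 2 * \<theta> * (1 / real (n i))" by simp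
  qed
  also have "\<dots> = 2 * \<theta> * inv_sizes" by (simp add: inv_sizes_def sum_distrib_left)
  finally have G2: "expectation (\<lambda>\<omega>. G \<omega> ^ 2) \<le> 2 * \<theta> * inv_sizes" .
  have G: "integrable M G" unfolding G_def using integrable_g[of _ "\<lambda>x. x"] by auto
  have R: "R = (\<lambda>\<omega>. - G \<omega> - (H \<omega> - \<theta>))" by (simp add: R_def fun_eq_iff G_def H_def)
  show int: "integrable M R" unfolding R using G H by auto
  have "expectation (\<lambda>\<omega>. \<bar>R \<omega>\<bar>) \<le> expectation (\<lambda>\<omega>. \<bar>G \<omega>\<bar> + (H \<omega> + \<theta>))"
  proof (rule integral_mono)
    show "\<bar>R \<omega>\<bar> \<le> \<bar>G \<omega>\<bar> + (H \<omega> + \<theta>)" for \<omega>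
      using H(3)[of \<omega>] theta_bounds unfolding R by linarith
  qed (use int G H in auto)
  also have "\<dots> = expectation (\<lambda>\<omega>. \<bar>G \<omega>\<bar>) + 2 * \<theta>" using G H by (simp add: prob_space)
  also have "expectation (\<lambda>\<omega>. \<bar>G \<omega>\<bar>) \<le> sqrt (expectation (\<lambda>\<omega>. G \<omega> ^ 2))"
    using sq G by (intro expectation_abs_le_sqrt) auto
  also have "\<dots> \<le> sqrt (2 * \<theta> * inv_sizes)" using G2 by simp
  finally show "expectation (\<lambda>\<omega>. \<bar>R \<omega>\<bar>) \<le> sqrt (2 * \<theta> * inv_sizes) + 2 * \<theta>" by simp
qed

end

section \<open>Mean absolute error of the variance estimators\<close>

context binomial_samples
begin

text \<open>The parameters \<open>m\<close> and \<open>r\<close> serve both estimators: group size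
  with group proportion, or total size with pooled proportion. Each summand costs
  \<open>500 / n i\<close> for passing to \<open>2 * (r * (1 - r)) ^ 2\<close> and then
  \<open>\<bar>r - p\<bar>\<close> for passing to \<open>2 * \<theta> ^ 2\<close>.\<close>

lemma variance_estimator_L1:
  fixes m :: "nat \<Rightarrow> nat" and r :: "nat \<Rightarrow> 'a \<Rightarrow> real"
  assumes m: "\<And>i. i \<in> {1..k} \<Longrightarrow> n i \<le> m i"
    and bounds: "AE \<omega> in M. \<forall>i\<in>{1..k}. 0 \<le> r i \<omega> \<and> r i \<omega> \<le> 1"
    and rv: "\<And>i. i \<in> {1..k} \<Longrightarrow> random_variable borel (r i)"
    and int: "\<And>i. i \<in> {1..k} \<Longrightarrow> integrable M (\<lambda>\<omega>. (r i \<omega> - p) ^ 2)"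
    and msd: "\<And>i. i \<in> {1..k} \<Longrightarrow> expectation (\<lambda>\<omega>. (r i \<omega> - p) ^ 2) \<le> \<theta> / real (n i)"
  defines "V \<equiv> \<lambda>\<omega>. \<Sum>i=1..k. \<Sum>l=1..4. a_coeff k n l i * eta_hat (m i) (r i \<omega>) l"
  shows "integrable M V"
    and "expectation (\<lambda>\<omega>. \<bar>V \<omega> - 2 * real k * \<theta> ^ 2\<bar>)
      \<le> 500 * inv_sizes + sqrt (real k * \<theta> * inv_sizes)"
proof -
  define D where "D \<omega> = (\<Sum>i=1..k. 500 / real (n i) + \<bar>r i \<omega> - p\<bar>)" for \<omega>
  have rp: "integrable M (\<lambda>\<omega>. \<bar>r i \<omega> - p\<bar>)" if "i \<in> {1..k}" for i
    using square_integrable_imp_integrable[OF _ int[OF that]] rv[OF that] by simp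
  have D: "integrable M D" unfolding D_def using rp by auto
  have Vm: "random_variable borel V"
    unfolding V_def eta_hat_def using rv by (intro borel_measurable_sum borel_measurable_times borel_measurable_prod) auto
  have le: "AE \<omega> in M. \<bar>V \<omega> - 2 * real k * \<theta> ^ 2\<bar> \<le> D \<omega>"
    using bounds
  proof eventually_elim
    case (elim \<omega>)
    have "V \<omega> - 2 * real k * \<theta> ^ 2
      = (\<Sum>i=1..k. (\<Sum>l=1..4. a_coeff k n l i * eta_hat (m i) (r i \<omega>) l) - 2 * \<theta> ^ 2)"
      by (simp add: V_def sum_subtractf)
    also have "\<bar>\<dots>\<bar> \<le> D \<omega>"
      unfolding D_def
    proof (rule order_trans[OF sum_abs sum_mono])
      fix i assume i: "i \<in> {1..k}"
      have r: "0 \<le> r i \<omega>" "r i \<omega> \<le> 1" using elim i by auto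
      show "\<bar>(\<Sum>l=1..4. a_coeff k n l i * eta_hat (m i) (r i \<omega>) l) - 2 * \<theta> ^ 2\<bar>
          \<le> 500 / real (n i) + \<bar>r i \<omega> - p\<bar>"
        using variance_summand_approx[where n=n, OF i size[OF i] m[OF i] r]
          square_mult_one_minus_lipschitz(2)[of p "r i \<omega>", folded \<theta>] p r by linarith
    qed
    finally show ?case .
  qed
  have "integrable M (\<lambda>\<omega>. V \<omega> - 2 * real k * \<theta> ^ 2)"
    by (rule Bochner_Integration.integrable_bound[OF D]) (use Vm le in \<open>auto elim!: eventually_mono\<close>)
  from Bochner_Integration.integrable_add[OF this integrable_const[of "2 * real k * \<theta> ^ 2"]]
  show V: "integrable M V" by simp
  have "expectation (\<lambda>\<omega>. \<bar>V \<omega> - 2 * real k * \<theta> ^ 2\<bar>) \<le> expectation D"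
    using V D le by (intro integral_mono_AE) auto
  also have "\<dots> = 500 * inv_sizes + (\<Sum>i=1..k. expectation (\<lambda>\<omega>. \<bar>r i \<omega> - p\<bar>))"
  proof -
    have "expectation D = (\<Sum>i=1..k. expectation (\<lambda>\<omega>. 500 / real (n i) + \<bar>r i \<omega> - p\<bar>))"
      unfolding D_def using rp by (intro Bochner_Integration.integral_sum) auto
    also have "\<dots> = (\<Sum>i=1..k. 500 * (1 / real (n i)) + expectation (\<lambda>\<omega>. \<bar>r i \<omega> - p\<bar>))"
      using rp by (intro sum.cong refl) (simp add: prob_space)
    finally show ?thesis by (simp add: sum.distrib inv_sizes_def sum_distrib_left)
  qed
  also have "(\<Sum>i=1..k. expectation (\<lambda>\<omega>. \<bar>r i \<omega> - p\<bar>)) \<le> (\<Sum>i=1..k. sqrt (\<theta> / real (n i)))"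
  proof (rule sum_mono)
    fix i assume i: "i \<in> {1..k}"
    have "expectation (\<lambda>\<omega>. \<bar>r i \<omega> - p\<bar>) \<le> sqrt (expectation (\<lambda>\<omega>. (r i \<omega> - p) ^ 2))"
      using rv[OF i] int[OF i] by (intro expectation_abs_le_sqrt) auto
    also have "\<dots> \<le> sqrt (\<theta> / real (n i))" using msd[OF i] by simp
    finally show "expectation (\<lambda>\<omega>. \<bar>r i \<omega> - p\<bar>) \<le> sqrt (\<theta> / real (n i))" .
  qed
  \<comment> \<open>Cauchy-Schwarz over the \<open>k\<close> groups.\<close>
  also have "(\<Sum>i=1..k. sqrt (\<theta> / real (n i))) \<le> sqrt (real k * \<theta> * inv_sizes)"
  proof (rule real_le_rsqrt)
    have "(\<Sum>i=1..k. sqrt (\<theta> / real (n i))) ^ 2 \<le> (\<Sum>i=1..k. (sqrt (\<theta> / real (n i))) ^ 2) * real (card {1..k})"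
      by (rule sum_squared_le_sum_of_squares)
    also have "(\<Sum>i=1..k. (sqrt (\<theta> / real (n i))) ^ 2) = \<theta> * inv_sizes"
      unfolding inv_sizes_def sum_distrib_left using theta_bounds by (intro sum.cong) auto
    finally show "(\<Sum>i=1..k. sqrt (\<theta> / real (n i))) ^ 2 \<le> real k * \<theta> * inv_sizes"
      by (simp add: algebra_simps)
  qed
  finally show "expectation (\<lambda>\<omega>. \<bar>V \<omega> - 2 * real k * \<theta> ^ 2\<bar>)
      \<le> 500 * inv_sizes + sqrt (real k * \<theta> * inv_sizes)" by simp
qed

lemma rv_pooled: "random_variable borel pooled"
  unfolding pooled_eq[abs_def] Y_def using rv_comp by (intro borel_measurable_add borel_measurable_divide borel_measurable_sum) auto

lemma V1_hat_L1:
  "integrable M (\<lambda>\<omega>. V1_hat k n (\<lambda>i. X i \<omega>))"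
  "expectation (\<lambda>\<omega>. \<bar>V1_hat k n (\<lambda>i. X i \<omega>) - 2 * real k * \<theta> ^ 2\<bar>)
     \<le> 500 * inv_sizes + sqrt (real k * \<theta> * inv_sizes)"
proof -
  have "AE \<omega> in M. \<forall>i\<in>{1..k}. 0 \<le> q i \<omega> \<and> q i \<omega> \<le> 1"
    using AE_X by eventually_elim (auto dest!: bspec q_bounds)
  moreover have "random_variable borel (q i)" if "i \<in> {1..k}" for i
    unfolding q_def[abs_def] pi_hat_def by (rule rv_comp[OF that])
  ultimately show "integrable M (\<lambda>\<omega>. V1_hat k n (\<lambda>i. X i \<omega>))"
    "expectation (\<lambda>\<omega>. \<bar>V1_hat k n (\<lambda>i. X i \<omega>) - 2 * real k * \<theta> ^ 2\<bar>)
     \<le> 500 * inv_sizes + sqrt (real k * \<theta> * inv_sizes)"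
    unfolding V1_hat_def q_def[symmetric] by (intro variance_estimator_L1; simp add: q_msd)+
qed

lemma V1_star_hat_L1:
  "integrable M (\<lambda>\<omega>. V1_star_hat k n (\<lambda>i. X i \<omega>))"
  "expectation (\<lambda>\<omega>. \<bar>V1_star_hat k n (\<lambda>i. X i \<omega>) - 2 * real k * \<theta> ^ 2\<bar>)
     \<le> 500 * inv_sizes + sqrt (real k * \<theta> * inv_sizes)"
proof -
  have "AE \<omega> in M. \<forall>i\<in>{1..k}. 0 \<le> pooled \<omega> \<and> pooled \<omega> \<le> 1"
    using AE_X by eventually_elim (blast intro: pooled_bounds)
  moreover have "integrable M (\<lambda>\<omega>. (pooled \<omega> - p) ^ 2)"
    using sum_Y_square(1) by (simp add: pooled_eq power_divide)
  moreover have "expectation (\<lambda>\<omega>. (pooled \<omega> - p) ^ 2) \<le> \<theta> / real (n i)" if i: "i \<in> {1..k}" for i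
  proof -
    \<comment> \<open>The pooled proportion has variance \<open>\<theta> / N\<close>, which is below
      the bound required for every single group.\<close>
    have "expectation (\<lambda>\<omega>. (pooled \<omega> - p) ^ 2) = \<theta> / N"
      using sum_Y_square N_pos by (simp add: pooled_eq power_divide) (simp add: power2_eq_square)
    also have "\<dots> \<le> \<theta> / real (n i)"
      using theta_bounds N_ge[OF i] n_ge[OF i] by (intro divide_left_mono) auto
    finally show ?thesis .
  qed
  ultimately show "integrable M (\<lambda>\<omega>. V1_star_hat k n (\<lambda>i. X i \<omega>))"
    "expectation (\<lambda>\<omega>. \<bar>V1_star_hat k n (\<lambda>i. X i \<omega>) - 2 * real k * \<theta> ^ 2\<bar>)
     \<le> 500 * inv_sizes + sqrt (real k * \<theta> * inv_sizes)"
    unfolding V1_star_hat_def pooled_def[symmetric]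
    by (intro variance_estimator_L1; simp add: size_le_total_size rv_pooled)+
qed

section \<open>Normalization by the leading standard deviation\<close>

definition c :: real where "c = inv_sizes / (real k * \<theta> ^ 3)"

lemma c_nonneg: "c \<ge> 0"
  using theta_bounds by (simp add: c_def inv_sizes_def sum_nonneg)

lemma inv_sizes_eq: "inv_sizes = c * real k * \<theta> ^ 3"
  using theta_bounds k by (simp add: c_def)

lemma s_pos: "s > 0"
  using theta_bounds k by (simp add: s_def)

lemma s_square: "s ^ 2 = 2 * real k * \<theta> ^ 2"
  by (simp add: s_def power_mult_distrib)

lemma s_ge: "s \<ge> \<theta> * sqrt (real k)"
  using theta_bounds by (simp add: s_def)

lemma theta_power_le_1: "\<theta> ^ j \<le> 1"
  using theta_bounds by (intro power_le_one) auto

text \<open>The term \<open>2 * \<theta> ^ 2\<close> in the variance of each \<open>Z i\<close> sums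
  to \<open>s ^ 2\<close>; the remaining term, rewritten through \<open>inv_sizes_eq\<close>, is a
  bounded multiple of \<open>c\<close> after division.\<close>

lemma lyapunov_variance: "\<bar>(\<Sum>i=1..k. expectation (\<lambda>\<omega>. (Z i \<omega> / s) ^ 2)) - 1\<bar> \<le> c"
proof -
  have "(\<Sum>i=1..k. expectation (\<lambda>\<omega>. (Z i \<omega> / s) ^ 2)) = (\<Sum>i=1..k. 2 * \<theta> ^ 2 + \<theta> * (1 - 6 * \<theta>) * (1 / real (n i))) / s ^ 2"
    unfolding sum_divide_distrib by (intro sum.cong refl) (simp add: power_divide variance_Z)
  also have "\<dots> = (s ^ 2 + \<theta> * (1 - 6 * \<theta>) * inv_sizes) / s ^ 2"
    by (simp add: sum.distrib s_square inv_sizes_def sum_distrib_left)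
  also have "\<dots> - 1 = \<theta> ^ 2 * (1 - 6 * \<theta>) / 2 * c"
    unfolding s_square inv_sizes_eq using theta_bounds k by (simp add: field_simps eval_nat_numeral)
  also have "\<bar>\<dots>\<bar> \<le> 1 * c"
  proof -
    have "\<bar>\<theta> ^ 2\<bar> \<le> 1" "\<bar>(1 - 6 * \<theta>) / 2\<bar> \<le> 1" using theta_power_le_1[of 2] theta_bounds by auto
    from abs_mult_le[OF this] show ?thesis using c_nonneg unfolding abs_mult by (intro mult_mono) (auto simp: abs_mult)
  qed
  finally show ?thesis by simp
qed

text \<open>The sum of third moments is of order \<open>k * \<theta> ^ 3\<close> and
  \<open>s ^ 3\<close> is at least \<open>(\<theta> * sqrt k) ^ 3\<close>, which leaves
  \<open>1 / sqrt k\<close>.\<close>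

lemma lyapunov_third: "(\<Sum>i=1..k. expectation (\<lambda>\<omega>. \<bar>Z i \<omega> / s\<bar> ^ 3)) \<le> (64 + 104 * c) / sqrt (real k)"
proof -
  have "(\<Sum>i=1..k. expectation (\<lambda>\<omega>. \<bar>Z i \<omega> / s\<bar> ^ 3)) = (\<Sum>i=1..k. expectation (\<lambda>\<omega>. \<bar>Z i \<omega>\<bar> ^ 3)) / s ^ 3"
    using s_pos by (simp add: abs_divide power_divide sum_divide_distrib)
  also have "\<dots> \<le> (\<Sum>i=1..k. 64 * \<theta> ^ 3 + 104 * \<theta> * (1 / real (n i))) / s ^ 3"
    using third_moment_Z s_pos by (intro divide_right_mono sum_mono) auto
  also have "(\<Sum>i=1..k. 64 * \<theta> ^ 3 + 104 * \<theta> * (1 / real (n i))) = \<theta> ^ 3 * real k * (64 + 104 * \<theta> * c)"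
  proof -
    have "(\<Sum>i=1..k. 64 * \<theta> ^ 3 + 104 * \<theta> * (1 / real (n i))) = 64 * real k * \<theta> ^ 3 + 104 * \<theta> * inv_sizes"
      by (simp add: sum.distrib inv_sizes_def sum_distrib_left)
    then show ?thesis by (simp add: inv_sizes_eq algebra_simps)
  qed
  also have "\<dots> / s ^ 3 \<le> \<theta> ^ 3 * real k * (64 + 104 * \<theta> * c) / (\<theta> * sqrt (real k)) ^ 3"
    using theta_bounds k c_nonneg s_ge s_pos
    by (intro divide_left_mono power_mono mult_nonneg_nonneg mult_pos_pos zero_less_power add_nonneg_nonneg) auto
  also have "\<dots> = (64 + 104 * (\<theta> * c)) / sqrt (real k)"
    using theta_bounds k by (simp add: power_mult_distrib power3_eq_cube field_simps)
  also have "\<dots> \<le> (64 + 104 * c) / sqrt (real k)"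
    using theta_bounds c_nonneg by (intro divide_right_mono add_left_mono mult_left_mono mult_left_le_one_le) auto
  finally show ?thesis .
qed

text \<open>Because \<open>2 * \<theta> * inv_sizes = (s * \<theta>) ^ 2 * c\<close>, the
  \<open>d\<close>-terms contribute at most \<open>sqrt c\<close>; the quadratic term contributes
  \<open>2 / sqrt k\<close>.\<close>

lemma R_normalized: "expectation (\<lambda>\<omega>. \<bar>R \<omega> / s\<bar>) \<le> sqrt c + 2 / sqrt (real k)"
proof -
  have "expectation (\<lambda>\<omega>. \<bar>R \<omega> / s\<bar>) = expectation (\<lambda>\<omega>. \<bar>R \<omega>\<bar>) / s"
    using s_pos by (simp add: abs_divide)
  also have "\<dots> \<le> (sqrt (2 * \<theta> * inv_sizes) + 2 * \<theta>) / s"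
    using R_bound(2) s_pos by (intro divide_right_mono) auto
  also have "2 * \<theta> * inv_sizes = (s * \<theta>) ^ 2 * c"
    unfolding inv_sizes_eq power_mult_distrib s_square by (simp add: eval_nat_numeral)
  also have "sqrt \<dots> = s * \<theta> * sqrt c"
    using s_pos theta_bounds by (simp add: real_sqrt_mult)
  also have "(s * \<theta> * sqrt c + 2 * \<theta>) / s = \<theta> * sqrt c + 2 * \<theta> / s"
    using s_pos by (simp add: field_simps)
  also have "\<dots> \<le> 1 * sqrt c + 2 * \<theta> / (\<theta> * sqrt (real k))"
    using theta_bounds s_ge s_pos c_nonneg k by (intro add_mono mult_right_mono divide_left_mono mult_pos_pos) auto
  finally show ?thesis using theta_bounds by simp
qed

text \<open>Divided by \<open>s ^ 2\<close>, the two error terms become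
  \<open>250 * \<theta> * c\<close> and \<open>sqrt c / 2\<close>.\<close>

lemma variance_normalized:
  assumes "expectation (\<lambda>\<omega>. \<bar>V \<omega> - 2 * real k * \<theta> ^ 2\<bar>) \<le> 500 * inv_sizes + sqrt (real k * \<theta> * inv_sizes)"
  shows "expectation (\<lambda>\<omega>. \<bar>V \<omega> / s ^ 2 - 1\<bar>) \<le> 500 * c + sqrt c"
proof -
  have "expectation (\<lambda>\<omega>. \<bar>V \<omega> / s ^ 2 - 1\<bar>) = expectation (\<lambda>\<omega>. \<bar>V \<omega> - s ^ 2\<bar> / s ^ 2)"
    using s_pos by (intro Bochner_Integration.integral_cong) (auto simp: field_simps abs_if)
  also have "\<dots> = expectation (\<lambda>\<omega>. \<bar>V \<omega> - 2 * real k * \<theta> ^ 2\<bar>) / s ^ 2" by (simp add: s_square)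
  also have "\<dots> \<le> (500 * inv_sizes + sqrt (real k * \<theta> * inv_sizes)) / s ^ 2"
    using assms by (intro divide_right_mono) auto
  also have "real k * \<theta> * inv_sizes = (real k * \<theta> ^ 2) ^ 2 * c"
    by (simp add: inv_sizes_eq power_mult_distrib eval_nat_numeral)
  also have "sqrt \<dots> = real k * \<theta> ^ 2 * sqrt c" by (simp add: real_sqrt_mult)
  also have "(500 * inv_sizes + real k * \<theta> ^ 2 * sqrt c) / s ^ 2 = (500 * (\<theta> * c) + sqrt c) / 2"
    unfolding s_square inv_sizes_eq using theta_bounds k by (simp add: field_simps eval_nat_numeral)
  also have "\<dots> \<le> 500 * (\<theta> * c) + sqrt c" using theta_bounds c_nonneg by simp
  also have "\<dots> \<le> 500 * c + sqrt c"
    using theta_bounds c_nonneg by (intro add_right_mono mult_left_mono mult_left_le_one_le) auto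
  finally show ?thesis .
qed

lemma rv_T: "random_variable borel (\<lambda>\<omega>. T_stat k n (\<lambda>i. X i \<omega>))"
  unfolding T_decomposition Z_def Y_def
  using rv_comp R_bound(1) by (intro borel_measurable_add borel_measurable_sum) auto

lemma indep_Z: "indep_vars (\<lambda>_. borel) (\<lambda>i \<omega>. Z i \<omega> / s) {1..k}"
  unfolding Z_def Y_def by (rule indep_comp)

lemma integrable_Z3_normalized: "i \<in> {1..k} \<Longrightarrow> integrable M (\<lambda>\<omega>. \<bar>Z i \<omega> / s\<bar> ^ 3)"
  unfolding Z_def Y_def by (rule integrable_comp)

end

section \<open>Asymptotic normality\<close>

text \<open>The estimator \<open>V\<close> stays abstract so that one argument covers both
  statistics. Separating the row index from the number of groups \<open>K j\<close> permits shifting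
  the rows by one.\<close>

theorem studentized_binomial_clt:
  fixes M :: "nat \<Rightarrow> 'a measure" and X :: "nat \<Rightarrow> nat \<Rightarrow> 'a \<Rightarrow> nat" and n :: "nat \<Rightarrow> nat \<Rightarrow> nat"
    and K :: "nat \<Rightarrow> nat" and p \<theta> :: "nat \<Rightarrow> real" and V r :: "nat \<Rightarrow> 'a \<Rightarrow> real"
  assumes samples: "\<And>j. binomial_samples (M j) (X j) (n j) (K j) (p j) (\<theta> j)"
    and K: "filterlim K at_top sequentially"
    and c: "(\<lambda>j. (\<Sum>i=1..K j. 1 / real (n j i)) / (real (K j) * \<theta> j ^ 3)) \<longlonglongrightarrow> 0"
    and V: "\<And>j. integrable (M j) (V j)"
    and V_L1: "\<And>j. (\<integral>\<omega>. \<bar>V j \<omega> - 2 * real (K j) * \<theta> j ^ 2\<bar> \<partial>M j)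
      \<le> 500 * (\<Sum>i=1..K j. 1 / real (n j i)) + sqrt (real (K j) * \<theta> j * (\<Sum>i=1..K j. 1 / real (n j i)))"
    and r: "\<And>j. r j \<in> borel_measurable (M j)"
  shows "weak_conv_m
    (\<lambda>j. distr (M j) borel (\<lambda>\<omega>. if V j \<omega> > 0 then T_stat (K j) (n j) (\<lambda>i. X j i \<omega>) / sqrt (V j \<omega>) else r j \<omega>))
    std_normal_distribution"
proof -
  interpret B: binomial_samples "M j" "X j" "n j" "K j" "p j" "\<theta> j" for j
    by (rule samples)
  have c0: "B.c \<longlonglongrightarrow> 0" using c unfolding B.c_def[abs_def] B.inv_sizes_def .
  have sqrt_c: "(\<lambda>j. sqrt (B.c j)) \<longlonglongrightarrow> 0" using tendsto_real_sqrt[OF c0] by simp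
  have k0: "(\<lambda>j. 1 / sqrt (real (K j))) \<longlonglongrightarrow> 0"
  proof -
    have "((\<lambda>k. 1 / sqrt (real k)) \<longlongrightarrow> 0) at_top" by real_asymp
    then show ?thesis using K by (rule filterlim_compose)
  qed
  have clt: "weak_conv_m (\<lambda>j. distr (M j) borel (\<lambda>\<omega>. \<Sum>i=1..K j. B.Z j i \<omega> / B.s j)) std_normal_distribution"
  proof (rule lyapunov_central_limit)
    show "(\<lambda>j. \<Sum>i=1..K j. \<integral>\<omega>. (B.Z j i \<omega> / B.s j) ^ 2 \<partial>M j) \<longlonglongrightarrow> 1"
      by (rule LIM_zero_cancel, rule Lim_null_comparison[OF _ c0]) (use B.lyapunov_variance in auto)
    have "(\<lambda>j. (64 + 104 * B.c j) * (1 / sqrt (real (K j)))) \<longlonglongrightarrow> (64 + 104 * 0) * 0"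
      by (intro tendsto_intros c0 k0)
    then have lim: "(\<lambda>j. (64 + 104 * B.c j) / sqrt (real (K j))) \<longlonglongrightarrow> 0" by simp
    show "(\<lambda>j. \<Sum>i=1..K j. \<integral>\<omega>. \<bar>B.Z j i \<omega> / B.s j\<bar> ^ 3 \<partial>M j) \<longlonglongrightarrow> 0"
      by (rule tendsto_sandwich[OF _ _ tendsto_const lim])
        (rule always_eventually, rule allI, (rule B.lyapunov_third | rule sum_nonneg, simp))+
  qed (use B.prob_space_axioms B.indep_Z B.integrable_Z3_normalized B.expectation_Z in simp_all)
  show ?thesis
  proof (rule weak_conv_m_studentized[OF _ _ _ _ _ clt isCont_cdf_std_normal])
    fix j
    show "prob_space (M j)" by (rule B.prob_space_axioms)
    show "(\<lambda>\<omega>. \<Sum>i=1..K j. B.Z j i \<omega> / B.s j) \<in> borel_measurable (M j)"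
      using B.indep_Z[of j] by (intro borel_measurable_sum) (auto simp: B.indep_vars_def)
    show "(\<lambda>\<omega>. if V j \<omega> > 0 then T_stat (K j) (n j) (\<lambda>i. X j i \<omega>) / sqrt (V j \<omega>) else r j \<omega>) \<in> borel_measurable (M j)"
    proof -
      note [measurable] = r[of j] borel_measurable_integrable[OF V[of j]] B.rv_T[of j]
      show ?thesis by measurable
    qed
    show "integrable (M j) (\<lambda>\<omega>. B.R j \<omega> / B.s j)" "integrable (M j) (\<lambda>\<omega>. V j \<omega> / B.s j ^ 2)"
      using B.R_bound(1)[of j] V[of j] by auto
    \<comment> \<open>Dividing both \<open>T_stat\<close> and \<open>sqrt V\<close> by
      \<open>s\<close> leaves the ratio unchanged, and \<open>s > 0\<close> preserves the sign of
      \<open>V\<close>.\<close>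
    fix \<omega> assume "V j \<omega> / B.s j ^ 2 > 0"
    then have "V j \<omega> > 0" using B.s_pos[of j] by (simp add: zero_less_divide_iff)
    then show "(if V j \<omega> > 0 then T_stat (K j) (n j) (\<lambda>i. X j i \<omega>) / sqrt (V j \<omega>) else r j \<omega>)
      = ((\<Sum>i=1..K j. B.Z j i \<omega> / B.s j) + B.R j \<omega> / B.s j) / sqrt (V j \<omega> / B.s j ^ 2)"
      using B.s_pos[of j]
      by (simp add: B.T_decomposition real_sqrt_divide flip: sum_divide_distrib add_divide_distrib)
  next
    have "(\<lambda>j. sqrt (B.c j) + 2 * (1 / sqrt (real (K j)))) \<longlonglongrightarrow> 0 + 2 * 0"
      by (intro tendsto_intros sqrt_c k0)
    then have lim: "(\<lambda>j. sqrt (B.c j) + 2 / sqrt (real (K j))) \<longlonglongrightarrow> 0" by simp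
    show "(\<lambda>j. \<integral>\<omega>. \<bar>B.R j \<omega> / B.s j\<bar> \<partial>M j) \<longlonglongrightarrow> 0"
      by (rule tendsto_sandwich[OF _ _ tendsto_const lim])
        (rule always_eventually, rule allI, (rule B.R_normalized | rule Bochner_Integration.integral_nonneg, simp))+
    have "(\<lambda>j. 500 * B.c j + sqrt (B.c j)) \<longlonglongrightarrow> 500 * 0 + 0"
      by (intro tendsto_intros sqrt_c c0)
    then have lim: "(\<lambda>j. 500 * B.c j + sqrt (B.c j)) \<longlonglongrightarrow> 0" by simp
    show "(\<lambda>j. \<integral>\<omega>. \<bar>V j \<omega> / B.s j ^ 2 - 1\<bar> \<partial>M j) \<longlonglongrightarrow> 0"
      by (rule tendsto_sandwich[OF _ _ tendsto_const lim])
        (rule always_eventually, rule allI,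
          (rule B.variance_normalized[OF V_L1[folded B.inv_sizes_def]] | rule Bochner_Integration.integral_nonneg, simp))+
  qed
qed

theorem theorem2:
  fixes M :: "nat \<Rightarrow> 'a measure"
    and X :: "nat \<Rightarrow> nat \<Rightarrow> 'a \<Rightarrow> nat"
    and n :: "nat \<Rightarrow> nat \<Rightarrow> nat"
    and p \<theta> N :: "nat \<Rightarrow> real"
    and \<delta> :: real
    and r1 r2 :: "nat \<Rightarrow> 'a \<Rightarrow> real"
  assumes prob: "\<And>k. k \<ge> 1 \<Longrightarrow> prob_space (M k)"
    and indep: "\<And>k. k \<ge> 1 \<Longrightarrow>
          prob_space.indep_vars (M k) (\<lambda>_. count_space UNIV) (X k) {1..k}"
    and binomial: "\<And>k i. i \<in> {1..k} \<Longrightarrow>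
          distr (M k) (count_space UNIV) (X k i) = measure_pmf (binomial_pmf (n k i) (p k))"
    and size: "\<And>k i. i \<in> {1..k} \<Longrightarrow> n k i \<ge> 4"
    and p: "\<And>k. k \<ge> 1 \<Longrightarrow> 0 < p k \<and> p k < 1"
    and \<delta>: "\<delta> < 1" "\<And>k. k \<ge> 1 \<Longrightarrow> p k \<le> \<delta>"
    and \<theta>: "\<And>k. \<theta> k = p k * (1 - p k)"
    and N: "\<And>k. N k = real (total_size k (n k))"
    and cond1: "(\<lambda>k. (\<theta> k ^ 3 * (\<Sum>i=1..k. 1 / real (n k i))
                        + \<theta> k * (\<Sum>i=1..k. 1 / real (n k i) ^ 3))
                    / (real k * \<theta> k ^ 2
                        + \<theta> k / N k ^ 2 * (\<Sum>i=1..k. 1 / real (n k i))) ^ 2)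
                  \<longlonglongrightarrow> 0"
    and cond2: "(\<lambda>k. (\<Sum>i=1..k. 1 / real (n k i)) / (real k * \<theta> k ^ 3)) \<longlonglongrightarrow> 0"
    and r1: "\<And>k. k \<ge> 1 \<Longrightarrow> r1 k \<in> borel_measurable (M k)"
    and r2: "\<And>k. k \<ge> 1 \<Longrightarrow> r2 k \<in> borel_measurable (M k)"
  shows "weak_conv_m
           (\<lambda>k. distr (M k) borel (\<lambda>\<omega>. T_new1 (r1 k \<omega>) k (n k) (\<lambda>i. X k i \<omega>)))
           std_normal_distribution
       \<and> weak_conv_m
           (\<lambda>k. distr (M k) borel (\<lambda>\<omega>. T_new2 (r2 k \<omega>) k (n k) (\<lambda>i. X k i \<omega>)))
           std_normal_distribution"
proof -
  \<comment> \<open>The assumptions start at \<open>k = 1\<close> and the locale requires a nonempty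
    row, so the rows are indexed by \<open>Suc j\<close>.\<close>
  have samples: "binomial_samples (M (Suc j)) (X (Suc j)) (n (Suc j)) (Suc j) (p (Suc j)) (\<theta> (Suc j))" for j
    unfolding binomial_samples_def binomial_samples_axioms_def
    using prob[of "Suc j"] indep[of "Suc j"] binomial[of _ "Suc j"] size[of _ "Suc j"] p[of "Suc j"] \<theta>
    by auto
  interpret B: binomial_samples "M (Suc j)" "X (Suc j)" "n (Suc j)" "Suc j" "p (Suc j)" "\<theta> (Suc j)" for j
    by (rule samples)
  note clt = studentized_binomial_clt[OF samples filterlim_Suc LIMSEQ_Suc[OF cond2]]
  \<comment> \<open>Weak convergence is unaffected by dropping the row with index 0, so the shift
    can be undone.\<close>
  have Suc_conv: "weak_conv_m F \<mu>" if "weak_conv_m (\<lambda>j. F (Suc j)) \<mu>" for F and \<mu> :: "real measure"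
    using that unfolding weak_conv_m_def weak_conv_def by (auto intro: LIMSEQ_imp_Suc)
  have r: "r1 (Suc j) \<in> borel_measurable (M (Suc j))" "r2 (Suc j) \<in> borel_measurable (M (Suc j))" for j
    by (auto intro: r1 r2)
  show ?thesis
    unfolding T_new1_def T_new2_def
  proof (rule conjI; rule Suc_conv)
    show "weak_conv_m (\<lambda>j. distr (M (Suc j)) borel (\<lambda>\<omega>.
        if V1_hat (Suc j) (n (Suc j)) (\<lambda>i. X (Suc j) i \<omega>) > 0
        then T_stat (Suc j) (n (Suc j)) (\<lambda>i. X (Suc j) i \<omega>) / sqrt (V1_hat (Suc j) (n (Suc j)) (\<lambda>i. X (Suc j) i \<omega>))
        else r1 (Suc j) \<omega>)) std_normal_distribution"
      by (rule clt[OF B.V1_hat_L1[unfolded B.inv_sizes_def] r(1)])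
    show "weak_conv_m (\<lambda>j. distr (M (Suc j)) borel (\<lambda>\<omega>.
        if V1_star_hat (Suc j) (n (Suc j)) (\<lambda>i. X (Suc j) i \<omega>) > 0
        then T_stat (Suc j) (n (Suc j)) (\<lambda>i. X (Suc j) i \<omega>) / sqrt (V1_star_hat (Suc j) (n (Suc j)) (\<lambda>i. X (Suc j) i \<omega>))
        else r2 (Suc j) \<omega>)) std_normal_distribution"
      by (rule clt[OF B.V1_star_hat_L1[unfolded B.inv_sizes_def] r(2)])
  qed
qed

end
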